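(* For every $\alpha\in(0,1]$ there exist constants $c(\alpha),C(\alpha)>0$, depending only on $\alpha$, such that the following holds. Let $n\ge 1$ and let $f:\mathbb R^n\to\mathbb R$ be a convex and $L$-Lipschitz map (with respect to the Euclidean norm), and let $Z\sim N(\mathbf 0,I_n)$. If $$\mathrm{Var}[f(Z)]\ge \alpha^2L^2,$$ then $$\mathbb P\big(|f(Z)-\mathrm{med}(f)|\ge tL\big)\ge c(\alpha)\exp\big(-C(\alpha)t^2\big)\qquad\text{for all } t>0.$$ Moreover, there are universal constants $c,C>0$ (independent of $\alpha$, $n$, $f$) such that one can take $c(\alpha)\ge c\,\alpha^8$ and $C(\alpha)\le C\alpha^{-4}\log(e/\alpha)$.
   Context: $Z\sim N(\mathbf 0,I_n)$ denotes a standard $n$-dimensional Gaussian random vector. $\mathrm{med}(f)$ denotes a median of the random variable $f(Z)$. *)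

theory Defs
  imports "HOL-Probability.Probability"
begin

text \<open>
  The dimension is quantified inside the statement (after the constants), so it cannot be a type.
  A point of Euclidean \<open>n\<close>-space is a function \<open>nat \<Rightarrow> real\<close> that is \<^const>\<open>undefined\<close> outside
  \<open>{..<n}\<close>; this is the carrier used by the library's product measures \<^const>\<open>PiM\<close>.
\<close>

definition Rn :: "nat \<Rightarrow> (nat \<Rightarrow> real) set" where
  "Rn n = {..<n} \<rightarrow>\<^sub>E UNIV"

definition std_gaussian :: "nat \<Rightarrow> (nat \<Rightarrow> real) measure" where
  "std_gaussian n = (\<Pi>\<^sub>M i\<in>{..<n}. density lborel (\<lambda>x. ennreal (std_normal_density x)))"

text \<open>
  The two predicates below are \<^const>\<open>convex_on\<close> and \<^const>\<open>lipschitz_on\<close> transcribed to the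
  carrier \<^const>\<open>Rn\<close>, which is not a type of class \<^class>\<open>real_normed_vector\<close>.
\<close>

definition convex_Rn :: "nat \<Rightarrow> ((nat \<Rightarrow> real) \<Rightarrow> real) \<Rightarrow> bool" where
  "convex_Rn n f \<longleftrightarrow>
     (\<forall>x\<in>Rn n. \<forall>y\<in>Rn n. \<forall>u\<ge>0. \<forall>v\<ge>0. u + v = 1 \<longrightarrow>
        f (\<lambda>i\<in>{..<n}. u * x i + v * y i) \<le> u * f x + v * f y)"

definition lipschitz_Rn :: "nat \<Rightarrow> real \<Rightarrow> ((nat \<Rightarrow> real) \<Rightarrow> real) \<Rightarrow> bool" where
  "lipschitz_Rn n L f \<longleftrightarrow>
     0 \<le> L \<and> (\<forall>x\<in>Rn n. \<forall>y\<in>Rn n. \<bar>f x - f y\<bar> \<le> L * L2_set (\<lambda>i. x i - y i) {..<n})"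

definition is_median :: "'a measure \<Rightarrow> ('a \<Rightarrow> real) \<Rightarrow> real \<Rightarrow> bool" where
  "is_median M X m \<longleftrightarrow>
     measure M {\<omega> \<in> space M. X \<omega> \<le> m} \<ge> 1/2 \<and> measure M {\<omega> \<in> space M. X \<omega> \<ge> m} \<ge> 1/2"

lemma space_std_gaussian: "space (std_gaussian n) = Rn n"
  by (simp add: std_gaussian_def Rn_def space_PiM)

lemma prob_space_std_gaussian: "prob_space (std_gaussian n)"
  unfolding std_gaussian_def by (intro prob_space_PiM prob_space_normal_density) simp

end

theory Submission
  imports Defs
begin

text \<open>
  For \<open>0 < r \<le> 1\<close> write \<open>Z = p X + r Y\<close> with \<open>p\<^sup>2 + r\<^sup>2 = 1\<close> and independent standard Gaussian \<open>X\<close>, \<open>Y\<close>,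
  and let \<open>b(X)\<close> be the gradient at \<open>0\<close> of the smooth convex function \<open>h \<mapsto> E[f(p X + r (Y + h)) | X]\<close>.
  Decomposing the variance along the scales \<open>r = 2\<^bsup>-j/2\<^esup>\<close> and bounding each piece by the Gaussian
  Poincare inequality gives a scale with \<open>E |b(X)|\<^sup>2 \<ge> \<alpha>\<^sup>2 r / 4\<close> (for \<open>L = 1\<close>), while \<open>|b| \<le> r\<close>.
  Shift \<open>Y\<close> by \<open>h = (\<kappa> / r) b(X)\<close>, which has length at most \<open>\<kappa>\<close>. By convexity the mean of \<open>f\<close> increases by
  at least \<open>\<kappa> \<alpha>\<^sup>2 / 4\<close>, so \<open>f\<close> itself increases by at least \<open>2 t = \<kappa> \<alpha>\<^sup>2 / 8\<close> with probability at least
  \<open>\<alpha>\<^sup>2 / 8\<close>. On this event either \<open>f \<le> m - t\<close> before the shift or \<open>f \<ge> m + t\<close> after it, for any real \<open>m\<close>,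
  and the shift costs only a factor of order \<open>\<alpha>\<^sup>2 exp (- \<kappa>\<^sup>2)\<close> in probability.
\<close>

section \<open>The standard Gaussian measure\<close>

text \<open>The splitting makes the shift direction independent of the shifted noise: given
  \<open>X\<close>, the vector \<open>h\<close> is constant and the shift of \<open>Y\<close> has an
  explicit density, whereas moving along a gradient taken at the shifted point itself would bring in
  a Jacobian. No fixed scale works. At r = 1 the vector b = E[f(Y) Y] does not depend on
  \<open>X\<close> and vanishes for every even f; for small r the bound |b| \<le> r only allows E
  |b|^2 of order r^2. The shift gains at least (\<kappa> / r) E |b|^2 on average, so the right
  demand is that E |b|^2 be at least a multiple of \<alpha>^2 r, which makes the gain free of r. It
  can be met because the energies over all scales add up to at least \<alpha>^2 while the scales r =
  2^(-j/2) are summable. The dimension enters only through an error r^2 n, which vanishes as r tends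
  to 0. As f need not be smooth, b is written as E[f(w + r Y) Y], and the regularity of the smoothed
  function comes from a subgradient inequality and a Lipschitz bound on b.\<close>

definition gauss :: "real measure" where
  "gauss = density lborel (\<lambda>x. ennreal (std_normal_density x))"

lemma sets_gauss[simp, measurable_cong]: "sets gauss = sets borel"
  by (simp add: gauss_def)

lemma space_gauss[simp]: "space gauss = UNIV"
  by (simp add: gauss_def)

lemma prob_space_gauss: "prob_space gauss"
  unfolding gauss_def by (intro prob_space_normal_density) simp

interpretation gauss: prob_space gauss
  by (rule prob_space_gauss)

interpretation gauss_prod: product_prob_space "\<lambda>_::nat. gauss" UNIV
  by unfold_locales

lemma std_gaussian_PiM: "std_gaussian n = PiM {..<n} (\<lambda>_. gauss)"
  by (simp add: std_gaussian_def gauss_def)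

lemma sets_std_gaussian[measurable_cong]: "sets (std_gaussian n) = sets (PiM {..<n} (\<lambda>_. borel))"
  unfolding std_gaussian_PiM by (intro sets_PiM_cong) auto

interpretation std_gaussian: prob_space "std_gaussian n" for n
  by (rule prob_space_std_gaussian)

interpretation std_gaussian_pair: pair_prob_space "std_gaussian n" "std_gaussian m" for n m
  by unfold_locales

text \<open>Beyond \<open>n\<close> a coordinate is the constant \<open>undefined\<close>, so the
  rule can go without the side condition i < n.\<close>

lemma measurable_std_gaussian_component[measurable (raw)]:
  "(\<lambda>x. x i) \<in> borel_measurable (std_gaussian n)"
proof (cases "i < n")
  case True
  then show ?thesis
    unfolding std_gaussian_PiM using measurable_component_singleton[of i "{..<n}" "\<lambda>_. gauss"] by simp
next
  case False
  then have "x i = undefined" if "x \<in> space (std_gaussian n)" for x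
    using that by (auto simp: space_std_gaussian Rn_def PiE_def extensional_def)
  then show ?thesis
    by (subst measurable_cong[of _ _ "\<lambda>_. undefined"]) auto
qed

lemma measurable_std_gaussian_pair_component[measurable]:
  "(\<lambda>p. fst p i) \<in> borel_measurable (std_gaussian n \<Otimes>\<^sub>M M)"
  "(\<lambda>p. snd p i) \<in> borel_measurable (M \<Otimes>\<^sub>M std_gaussian n)"
  by (rule measurable_compose[OF measurable_fst measurable_std_gaussian_component]
      measurable_compose[OF measurable_snd measurable_std_gaussian_component])+

text \<open>Cameron-Martin in one dimension: translation turns the density \<phi>(x) into \<phi>(x -
  h) = \<phi>(x) exp(h x - h^2 / 2).\<close>

lemma gauss_shift: "distr gauss borel (\<lambda>x. x + h) = density gauss (\<lambda>x. ennreal (exp (h * x - h\<^sup>2 / 2)))"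
proof -
  have "distr gauss borel (\<lambda>x. x + h) = density lborel (\<lambda>x. ennreal (std_normal_density (x - h)))"
  proof (rule measure_eqI)
    fix A assume "A \<in> sets (distr gauss borel (\<lambda>x. x + h))"
    then have A[measurable]: "A \<in> sets borel" by simp
    have "emeasure (distr gauss borel (\<lambda>x. x + h)) A
        = (\<integral>\<^sup>+x. ennreal (std_normal_density x) * indicator A (x + h) \<partial>lborel)"
    proof -
      have "(\<lambda>x. x + h) -` A \<in> sets borel"
        using measurable_sets_borel[of "\<lambda>x. x + h" borel A] by simp
      then show ?thesis
        unfolding gauss_def by (subst emeasure_distr)
           (auto simp: emeasure_density intro!: nn_integral_cong split: split_indicator)
    qed
    also have "\<dots> = (\<integral>\<^sup>+x. ennreal (std_normal_density (x - h)) * indicator A x \<partial>lborel)"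
      using nn_integral_real_affine[of "\<lambda>x. ennreal (std_normal_density (x - h)) * indicator A x" 1 h]
      by (simp add: add.commute)
    finally show "emeasure (distr gauss borel (\<lambda>x. x + h)) A
        = emeasure (density lborel (\<lambda>x. ennreal (std_normal_density (x - h)))) A"
      by (simp add: emeasure_density)
  qed simp
  also have "\<dots> = density lborel (\<lambda>x. ennreal (std_normal_density x) * ennreal (exp (h * x - h\<^sup>2 / 2)))"
    by (intro density_cong)
       (auto simp: std_normal_density_def ennreal_mult[symmetric] mult.assoc exp_add[symmetric]
          power2_eq_square field_simps)
  also have "\<dots> = density gauss (\<lambda>x. ennreal (exp (h * x - h\<^sup>2 / 2)))"
    unfolding gauss_def by (subst density_density_eq) auto
  finally show ?thesis .
qed

text \<open>The function exp(B x - B^2 / 2) has mass 1, being the density of the law translated by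
  \<open>B\<close>; integrability is read off from this.\<close>

lemma integrable_gauss_exp: "integrable gauss (\<lambda>x. exp (B * x))"
proof -
  have "integral\<^sup>N gauss (\<lambda>x. ennreal (exp (B * x - B\<^sup>2 / 2))) = 1"
  proof -
    have "(\<lambda>x. x + B) \<in> borel_measurable gauss" by measurable
    then have "emeasure (distr gauss borel (\<lambda>x. x + B)) UNIV = 1"
      using gauss.emeasure_space_1 by (simp add: emeasure_distr)
    then show ?thesis
      unfolding gauss_shift by (simp add: emeasure_density)
  qed
  then have "integrable gauss (\<lambda>x. exp (B * x - B\<^sup>2 / 2))"
    by (intro integrableI_nonneg) auto
  from integrable_mult_left[OF this, of "exp (B\<^sup>2/2)"]
  show ?thesis by (simp add: exp_add[symmetric] mult_exp_exp)
qed

lemma integrable_gauss_exp_abs: "integrable gauss (\<lambda>x. exp (B * \<bar>x\<bar>))"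
proof (rule Bochner_Integration.integrable_bound)
  show "integrable gauss (\<lambda>x. exp (B * x) + exp (- B * x))"
    by (intro Bochner_Integration.integrable_add integrable_gauss_exp)
  show "AE x in gauss. norm (exp (B * \<bar>x\<bar>)) \<le> norm (exp (B * x) + exp (- B * x))"
  proof (rule AE_I2)
    fix x :: real
    have "exp (B * \<bar>x\<bar>) \<le> exp (B * x) + exp (- B * x)"
      by (cases "x \<ge> 0") auto
    then show "norm (exp (B * \<bar>x\<bar>)) \<le> norm (exp (B * x) + exp (- B * x))" by simp
  qed
qed simp

text \<open>Dominating function for most later integrability claims. The exponent is the l1 norm
  because the exponential then factors over the coordinates.\<close>

lemma integrable_std_gaussian_exp:
  "integrable (std_gaussian n) (\<lambda>x. exp (B * (\<Sum>i<n. \<bar>x i\<bar>)))"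
proof -
  have "integrable (std_gaussian n) (\<lambda>x. \<Prod>i<n. exp (B * \<bar>x i\<bar>))"
    unfolding std_gaussian_PiM
    by (rule gauss_prod.product_integrable_prod) (auto simp: integrable_gauss_exp_abs)
  then show ?thesis by (simp add: exp_sum sum_distrib_left)
qed

lemma integrable_std_gaussian_bound:
  fixes h :: "(nat \<Rightarrow> real) \<Rightarrow> real" and A :: real
  assumes "h \<in> borel_measurable (std_gaussian n)"
    and "\<And>x. x \<in> Rn n \<Longrightarrow> \<bar>h x\<bar> \<le> A * exp (B * (\<Sum>i<n. \<bar>x i\<bar>))"
  shows "integrable (std_gaussian n) h"
proof (rule Bochner_Integration.integrable_bound)
  show "integrable (std_gaussian n) (\<lambda>x. A * exp (B * (\<Sum>i<n. \<bar>x i\<bar>)))"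
    by (intro integrable_mult_right integrable_std_gaussian_exp)
  show "AE x in std_gaussian n. norm (h x) \<le> norm (A * exp (B * (\<Sum>i<n. \<bar>x i\<bar>)))"
    using assms(2) by (intro AE_I2) (auto simp: space_std_gaussian intro: order_trans[OF _ abs_ge_self])
qed (rule assms(1))

section \<open>Rotation invariance and shifts of the Gaussian measure\<close>

lemma distr_gauss_fst: "distr (gauss \<Otimes>\<^sub>M gauss) borel fst = gauss"
  and distr_gauss_snd: "distr (gauss \<Otimes>\<^sub>M gauss) borel snd = gauss"
proof -
  show "distr (gauss \<Otimes>\<^sub>M gauss) borel fst = gauss"
    using gauss.distr_pair_fst[of gauss] by (metis distr_cong sets_gauss)
  show "distr (gauss \<Otimes>\<^sub>M gauss) borel snd = gauss"
  proof (rule measure_eqI)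
    fix A assume "A \<in> sets (distr (gauss \<Otimes>\<^sub>M gauss) borel snd)"
    then have A[measurable]: "A \<in> sets borel" by simp
    have "snd -` A \<inter> space (gauss \<Otimes>\<^sub>M gauss) = UNIV \<times> A" by (auto simp: space_pair_measure)
    then show "emeasure (distr (gauss \<Otimes>\<^sub>M gauss) borel snd) A = emeasure gauss A"
      using gauss.emeasure_space_1
      by (simp add: emeasure_distr gauss.emeasure_pair_measure_Times)
  qed simp
qed

text \<open>For positive \<open>a\<close> and \<open>b\<close> this is the sum rule for independent
  normal variables. The degenerate cases are marginals, treated apart because a normal density needs
  a positive deviation.\<close>

lemma gauss_convolution:
  assumes ab: "a\<^sup>2 + b\<^sup>2 = 1" "a \<ge> 0" "b \<ge> 0"
  shows "distr (gauss \<Otimes>\<^sub>M gauss) borel (\<lambda>(x, y). a * x + b * y) = gauss"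
proof -
  interpret P: pair_prob_space gauss gauss ..
  consider "a = 0" "b = 1" | "b = 0" "a = 1" | "a > 0" "b > 0"
    using ab by (cases "a = 0"; cases "b = 0") (auto simp: power2_eq_1_iff)
  then show ?thesis
  proof cases
    case 1
    then show ?thesis using distr_gauss_snd by (simp add: case_prod_beta')
  next
    case 2
    then show ?thesis using distr_gauss_fst by (simp add: case_prod_beta')
  next
    case 3
    have normal: "distributed (gauss \<Otimes>\<^sub>M gauss) lborel X std_normal_density"
      if "distr (gauss \<Otimes>\<^sub>M gauss) borel X = gauss" "X \<in> borel_measurable (gauss \<Otimes>\<^sub>M gauss)" for X
    proof -
      have "distr (gauss \<Otimes>\<^sub>M gauss) lborel X = distr (gauss \<Otimes>\<^sub>M gauss) borel X"
        by (rule distr_cong) auto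
      with that show ?thesis
        unfolding distributed_def by (auto simp: gauss_def)
    qed
    have X: "distributed (gauss \<Otimes>\<^sub>M gauss) lborel (\<lambda>p. 0 + a * fst p) (normal_density (0 + a * 0) (\<bar>a\<bar> * 1))"
      using 3 by (intro P.normal_density_affine normal distr_gauss_fst) auto
    have Y: "distributed (gauss \<Otimes>\<^sub>M gauss) lborel (\<lambda>p. 0 + b * snd p) (normal_density (0 + b * 0) (\<bar>b\<bar> * 1))"
      using 3 by (intro P.normal_density_affine normal distr_gauss_snd) auto
    have "gauss \<Otimes>\<^sub>M gauss = distr (gauss \<Otimes>\<^sub>M gauss) (borel \<Otimes>\<^sub>M borel) (\<lambda>p. (fst p, snd p))"
      by (simp only: prod.collapse, intro distr_id2[symmetric] sets_pair_measure_cong) simp_all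
    then have "P.indep_var borel fst borel snd"
      unfolding P.indep_var_distribution_eq distr_gauss_fst distr_gauss_snd by simp
    then have "P.indep_var borel ((\<lambda>x. 0 + a * x) \<circ> fst) borel ((\<lambda>x. 0 + b * x) \<circ> snd)"
      by (rule P.indep_var_compose) auto
    then have "distributed (gauss \<Otimes>\<^sub>M gauss) lborel (\<lambda>p. (0 + a * fst p) + (0 + b * snd p))
        (normal_density (0 + a * 0 + (0 + b * 0)) (sqrt ((\<bar>a\<bar> * 1)\<^sup>2 + (\<bar>b\<bar> * 1)\<^sup>2)))"
      using 3 by (intro P.add_indep_normal X Y) (auto simp: o_def)
    then have "distr (gauss \<Otimes>\<^sub>M gauss) lborel (\<lambda>p. a * fst p + b * snd p) = gauss"
      using ab by (simp add: distributed_def gauss_def)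
    moreover have "distr (gauss \<Otimes>\<^sub>M gauss) lborel (\<lambda>p. a * fst p + b * snd p)
        = distr (gauss \<Otimes>\<^sub>M gauss) borel (\<lambda>(x, y). a * x + b * y)"
      by (rule distr_cong) auto
    ultimately show ?thesis by simp
  qed
qed

lemma std_gaussian_eqI:
  assumes "sets P = sets (PiM {..<n} (\<lambda>_. borel :: real measure))"
    and "\<And>A. (\<And>i. A i \<in> sets borel) \<Longrightarrow> emeasure P (Pi\<^sub>E {..<n} A) = (\<Prod>i<n. emeasure gauss (A i))"
  shows "P = std_gaussian n"
  unfolding std_gaussian_PiM
proof (rule gauss_prod.PiM_eqI)
  show "sets P = sets (PiM {..<n} (\<lambda>_. gauss))"
    using assms(1) sets_std_gaussian by (simp add: std_gaussian_PiM)
next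
  fix A :: "nat \<Rightarrow> real set" assume A: "\<And>i. i \<in> {..<n} \<Longrightarrow> A i \<in> sets gauss"
  define A' where "A' i = (if i < n then A i else UNIV)" for i
  have "Pi\<^sub>E {..<n} A = Pi\<^sub>E {..<n} A'" by (intro PiE_cong) (auto simp: A'_def)
  then show "emeasure P (Pi\<^sub>E {..<n} A) = (\<Prod>i\<in>{..<n}. emeasure gauss (A i))"
    using assms(2)[of A'] A by (auto simp: A'_def)
qed simp

text \<open>The indicator of a box is a product over the coordinates, so Fubini reduces the claim to
  \<open>gauss_convolution\<close> in each of them.\<close>

lemma std_gaussian_convolution:
  assumes ab: "a\<^sup>2 + b\<^sup>2 = 1" "a \<ge> 0" "b \<ge> 0"
  shows "distr (std_gaussian n \<Otimes>\<^sub>M std_gaussian n) (std_gaussian n)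
    (\<lambda>(x, y). \<lambda>i\<in>{..<n}. a * x i + b * y i) = std_gaussian n" (is "distr ?P _ ?T = _")
proof (rule std_gaussian_eqI)
  have T[measurable]: "?T \<in> measurable ?P (std_gaussian n)"
    unfolding measurable_cong_sets[OF refl sets_std_gaussian] case_prod_beta'
    by (intro measurable_restrict) measurable
  fix A :: "nat \<Rightarrow> real set" assume A[measurable]: "\<And>i. A i \<in> sets borel"
  have A': "Pi\<^sub>E {..<n} A \<in> sets (std_gaussian n)"
    unfolding sets_std_gaussian by (intro sets_PiM_I_finite) auto
  have "emeasure (distr ?P (std_gaussian n) ?T) (Pi\<^sub>E {..<n} A)
      = (\<integral>\<^sup>+p. indicator (Pi\<^sub>E {..<n} A) (?T p) \<partial>?P)"
    using A' by (simp add: nn_integral_distr flip: nn_integral_indicator)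
  also have "\<dots> = (\<integral>\<^sup>+p. (\<Prod>i<n. indicator (A i) (a * fst p i + b * snd p i)) \<partial>?P)"
    by (intro nn_integral_cong)
       (auto simp: indicator_def PiE_iff prod_zero_iff case_prod_beta' split: if_splits)
  also have "\<dots> = (\<integral>\<^sup>+x. (\<integral>\<^sup>+y. (\<Prod>i<n. indicator (A i) (a * x i + b * y i)) \<partial>std_gaussian n) \<partial>std_gaussian n)"
    by (subst std_gaussian.nn_integral_fst[symmetric]) simp_all
  also have "\<dots> = (\<integral>\<^sup>+x. (\<Prod>i<n. \<integral>\<^sup>+y. indicator (A i) (a * x i + b * y) \<partial>gauss) \<partial>std_gaussian n)"
    unfolding std_gaussian_PiM
    by (intro nn_integral_cong gauss_prod.product_nn_integral_prod finite_lessThan) measurable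
  also have "\<dots> = (\<Prod>i<n. \<integral>\<^sup>+x. \<integral>\<^sup>+y. indicator (A i) (a * x + b * y) \<partial>gauss \<partial>gauss)"
    unfolding std_gaussian_PiM by (intro gauss_prod.product_nn_integral_prod finite_lessThan) measurable
  also have "\<dots> = (\<Prod>i<n. emeasure (distr (gauss \<Otimes>\<^sub>M gauss) borel (\<lambda>(x, y). a * x + b * y)) (A i))"
  proof (intro prod.cong refl)
    fix i
    have "(\<integral>\<^sup>+x. \<integral>\<^sup>+y. indicator (A i) (a * x + b * y) \<partial>gauss \<partial>gauss)
        = (\<integral>\<^sup>+p. indicator (A i) (a * fst p + b * snd p) \<partial>(gauss \<Otimes>\<^sub>M gauss))"
      by (subst gauss.nn_integral_fst[symmetric]) simp_all
    then show "(\<integral>\<^sup>+x. \<integral>\<^sup>+y. indicator (A i) (a * x + b * y) \<partial>gauss \<partial>gauss)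
        = emeasure (distr (gauss \<Otimes>\<^sub>M gauss) borel (\<lambda>(x, y). a * x + b * y)) (A i)"
      by (simp add: nn_integral_distr case_prod_beta' flip: nn_integral_indicator)
  qed
  finally show "emeasure (distr ?P (std_gaussian n) ?T) (Pi\<^sub>E {..<n} A) = (\<Prod>i<n. emeasure gauss (A i))"
    by (simp add: gauss_convolution[OF ab])
qed (simp add: sets_std_gaussian)

text \<open>Both sides equal the product of the shifted one-dimensional laws; on the right the
  exponential of the sum splits into the densities of \<open>gauss_shift\<close>.\<close>

lemma std_gaussian_shift:
  "distr (std_gaussian n) (std_gaussian n) (\<lambda>y. \<lambda>i\<in>{..<n}. y i + h i)
    = density (std_gaussian n) (\<lambda>y. ennreal (exp (\<Sum>i<n. h i * y i - (h i)\<^sup>2 / 2)))" (is "distr _ _ ?T = ?R")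
proof -
  have shift[measurable]: "(\<lambda>x. x + c) \<in> borel_measurable gauss" for c
    by measurable
  interpret S: product_sigma_finite "\<lambda>i::nat. distr gauss borel (\<lambda>x. x + h i)"
    by (rule product_sigma_finite.intro, rule prob_space_imp_sigma_finite, rule gauss.prob_space_distr, rule shift)
  have sets_eq: "sets (PiM {..<n} (\<lambda>i. distr gauss borel (\<lambda>x. x + h i))) = sets (std_gaussian n)"
    unfolding sets_std_gaussian by (intro sets_PiM_cong) auto
  have T[measurable]: "?T \<in> measurable (std_gaussian n) (std_gaussian n)"
    unfolding measurable_cong_sets[OF refl sets_std_gaussian]
    by (intro measurable_restrict) measurable
  have ind: "indicator (Pi\<^sub>E {..<n} A) (\<lambda>i\<in>{..<n}. x i) = (\<Prod>i<n. indicator (A i) (x i) :: ennreal)"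
    for A :: "nat \<Rightarrow> real set" and x
    by (auto simp: indicator_def PiE_iff prod_zero_iff split: if_splits)
  have "distr (std_gaussian n) (std_gaussian n) ?T = PiM {..<n} (\<lambda>i. distr gauss borel (\<lambda>x. x + h i))"
  proof (rule S.PiM_eqI)
    fix A :: "nat \<Rightarrow> real set" assume "\<And>i. i \<in> {..<n} \<Longrightarrow> A i \<in> sets (distr gauss borel (\<lambda>x. x + h i))"
    then have A[measurable]: "A i \<in> sets borel" if "i < n" for i using that by auto
    have A': "Pi\<^sub>E {..<n} A \<in> sets (std_gaussian n)"
      unfolding sets_std_gaussian by (intro sets_PiM_I_finite) (auto simp: A)
    have "emeasure (distr (std_gaussian n) (std_gaussian n) ?T) (Pi\<^sub>E {..<n} A)
        = (\<integral>\<^sup>+y. (\<Prod>i<n. indicator (A i) (y i + h i)) \<partial>std_gaussian n)"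
      using A' by (simp add: nn_integral_distr ind flip: nn_integral_indicator)
    also have "\<dots> = (\<Prod>i<n. \<integral>\<^sup>+y. indicator (A i) (y + h i) \<partial>gauss)"
      unfolding std_gaussian_PiM by (intro gauss_prod.product_nn_integral_prod) (auto simp: A)
    also have "\<dots> = (\<Prod>i<n. emeasure (distr gauss borel (\<lambda>x. x + h i)) (A i))"
      by (intro prod.cong refl) (simp add: A nn_integral_distr flip: nn_integral_indicator)
    finally show "emeasure (distr (std_gaussian n) (std_gaussian n) ?T) (Pi\<^sub>E {..<n} A)
        = (\<Prod>i\<in>{..<n}. emeasure (distr gauss borel (\<lambda>x. x + h i)) (A i))" .
  qed (simp_all add: sets_eq)
  moreover have "?R = PiM {..<n} (\<lambda>i. distr gauss borel (\<lambda>x. x + h i))"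
  proof (rule S.PiM_eqI)
    fix A :: "nat \<Rightarrow> real set" assume "\<And>i. i \<in> {..<n} \<Longrightarrow> A i \<in> sets (distr gauss borel (\<lambda>x. x + h i))"
    then have A[measurable]: "A i \<in> sets borel" if "i < n" for i using that by auto
    have A': "Pi\<^sub>E {..<n} A \<in> sets (std_gaussian n)"
      unfolding sets_std_gaussian by (intro sets_PiM_I_finite) (auto simp: A)
    have res: "(\<lambda>i\<in>{..<n}. y i) = y" if "y \<in> space (std_gaussian n)" for y
      using that by (simp add: space_std_gaussian Rn_def PiE_restrict)
    have "emeasure ?R (Pi\<^sub>E {..<n} A)
        = (\<integral>\<^sup>+y. ennreal (exp (\<Sum>i<n. h i * y i - (h i)\<^sup>2 / 2)) * indicator (Pi\<^sub>E {..<n} A) y \<partial>std_gaussian n)"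
      using A' by (simp add: emeasure_density)
    also have "\<dots> = (\<integral>\<^sup>+y. (\<Prod>i<n. ennreal (exp (h i * y i - (h i)\<^sup>2 / 2)) * indicator (A i) (y i)) \<partial>std_gaussian n)"
    proof (rule nn_integral_cong)
      fix y assume "y \<in> space (std_gaussian n)"
      from res[OF this] have "indicator (Pi\<^sub>E {..<n} A) y = (\<Prod>i<n. indicator (A i) (y i) :: ennreal)"
        using ind[of A y] by simp
      then show "ennreal (exp (\<Sum>i<n. h i * y i - (h i)\<^sup>2 / 2)) * indicator (Pi\<^sub>E {..<n} A) y
          = (\<Prod>i<n. ennreal (exp (h i * y i - (h i)\<^sup>2 / 2)) * indicator (A i) (y i))"
        by (simp add: exp_sum prod.distrib prod_ennreal)
    qed
    also have "\<dots> = (\<Prod>i<n. \<integral>\<^sup>+y. ennreal (exp (h i * y - (h i)\<^sup>2 / 2)) * indicator (A i) y \<partial>gauss)"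
      unfolding std_gaussian_PiM by (intro gauss_prod.product_nn_integral_prod) (auto simp: A)
    also have "\<dots> = (\<Prod>i<n. emeasure (distr gauss borel (\<lambda>x. x + h i)) (A i))"
      by (intro prod.cong refl) (simp add: A gauss_shift emeasure_density)
    finally show "emeasure ?R (Pi\<^sub>E {..<n} A)
        = (\<Prod>i\<in>{..<n}. emeasure (distr gauss borel (\<lambda>x. x + h i)) (A i))" .
  qed (simp_all add: sets_eq)
  ultimately show ?thesis by simp
qed

section \<open>The Gaussian Poincare inequality\<close>

lemma square_integral_le:
  assumes "prob_space M" "integrable M f" "integrable M (\<lambda>x. (f x)\<^sup>2)"
  shows "(\<integral>x. f x \<partial>M)\<^sup>2 \<le> (\<integral>x. (f x :: real)\<^sup>2 \<partial>M)"
proof -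
  interpret prob_space M by fact
  show ?thesis
    using variance_eq[OF assms(2,3)] variance_positive[of f] by simp
qed

section \<open>The Poincare inequality on the line\<close>

lemma integrable_gauss_bound:
  fixes h :: "real \<Rightarrow> real" and A :: real
  assumes "h \<in> borel_measurable borel" and "\<And>x. \<bar>h x\<bar> \<le> A * exp (B * \<bar>x\<bar>)"
  shows "integrable gauss h"
proof (rule Bochner_Integration.integrable_bound)
  show "integrable gauss (\<lambda>x. A * exp (B * \<bar>x\<bar>))"
    by (intro integrable_mult_right integrable_gauss_exp_abs)
  show "AE x in gauss. norm (h x) \<le> norm (A * exp (B * \<bar>x\<bar>))"
    using assms(2) by (intro AE_I2) (auto intro: order_trans[OF _ abs_ge_self])
qed (use assms(1) in \<open>simp add: measurable_cong_sets[OF sets_gauss refl]\<close>)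

lemma integral_gauss:
  fixes h :: "real \<Rightarrow> real"
  assumes [measurable]: "h \<in> borel_measurable borel"
  shows "(\<integral>x. h x \<partial>gauss) = (\<integral>x. std_normal_density x * h x \<partial>lborel)"
    and "integrable gauss h \<longleftrightarrow> integrable lborel (\<lambda>x. std_normal_density x * h x)"
  unfolding gauss_def by (subst integral_real_density integrable_real_density; simp)+

lemma DERIV_std_normal_density:
  "(std_normal_density has_real_derivative - x * std_normal_density x) (at x within S)"
proof -
  have "((\<lambda>x. (1 / sqrt (2 * pi)) * exp (- x\<^sup>2 / 2)) has_real_derivative
      (1 / sqrt (2 * pi)) * (exp (- x\<^sup>2 / 2) * - x)) (at x within S)"
    by (rule DERIV_cmult) (auto intro!: derivative_eq_intros)
  then show ?thesis
    unfolding std_normal_density_def[abs_def] by (simp add: mult_ac)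
qed

text \<open>A quadratic remainder bound is the form in which differentiability is assumed below,
  since it survives integration over other coordinates.\<close>

lemma DERIV_quadratic_remainder:
  fixes g :: "real \<Rightarrow> real"
  assumes "\<And>y. \<bar>g y - g x - b * (y - x)\<bar> \<le> K * (y - x)\<^sup>2"
  shows "(g has_real_derivative b) (at x)"
  unfolding has_field_derivative_iff
proof (rule Lim_transform_bound[where g = "\<lambda>y. K * \<bar>y - x\<bar>", THEN LIM_zero_cancel])
  have "norm ((g y - g x) / (y - x) - b) \<le> norm (K * \<bar>y - x\<bar>)" if "y \<noteq> x" for y
  proof -
    have "(g y - g x) / (y - x) - b = (g y - g x - b * (y - x)) / (y - x)"
      using that by (simp add: field_simps)
    then have "\<bar>(g y - g x) / (y - x) - b\<bar> = \<bar>g y - g x - b * (y - x)\<bar> / \<bar>y - x\<bar>"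
      by (simp add: abs_divide)
    also have "\<dots> \<le> K * (y - x)\<^sup>2 / \<bar>y - x\<bar>"
      using assms[of y] by (intro divide_right_mono) auto
    also have "\<dots> = K * \<bar>y - x\<bar>"
      using that by (simp add: power2_eq_square abs_if field_simps)
    finally show ?thesis by simp
  qed
  then show "\<forall>\<^sub>F y in at x. norm ((g y - g x) / (y - x) - b) \<le> norm (K * \<bar>y - x\<bar>)"
    by (auto simp: eventually_at_filter)
  show "((\<lambda>y. K * \<bar>y - x\<bar>) \<longlongrightarrow> 0) (at x)"
    by (auto intro!: tendsto_eq_intros)
qed

text \<open>A Hardy-type inequality, centred at \<open>g 0\<close> instead of the mean: the centring
  removes the boundary term at 0, and the one at \<open>R\<close> has the favourable sign. On both
  half-lines together, as \<open>R\<close> grows, it yields E (g - g 0)^2 \<le> E b^2, which is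
  stronger than the Poincare inequality.\<close>

lemma gauss_hardy_half:
  fixes g b :: "real \<Rightarrow> real"
  assumes deriv: "\<And>x. (g has_real_derivative b x) (at x)"
    and cont: "continuous_on UNIV b" and R: "R > 0"
  shows "0 \<le> integral {0..R} (\<lambda>x. std_normal_density x * ((b x)\<^sup>2 - (g x - g 0)\<^sup>2))"
proof -
  let ?\<phi> = std_normal_density
  define D where "D x = g x - g 0" for x
  define k where "k x = ?\<phi> x * ((b x)\<^sup>2 - (D x)\<^sup>2)" for x
  define F where "F x = ?\<phi> x * (D x)\<^sup>2 / x" for x
  \<comment> \<open>Since \<open>\<phi>' = - x \<phi>\<close>, completing the square gives \<open>F' = k - \<phi> (D / x - b)\<^sup>2 \<le> k\<close>;
    the junk value \<open>F 0 = 0\<close> is the limit of \<open>F\<close> at \<open>0\<close>.\<close>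
  have D: "(D has_real_derivative b x) (at x within S)" for x S
    unfolding D_def[abs_def] using has_field_derivative_at_within[OF deriv, of x S]
    by (auto intro!: derivative_eq_intros)
  have contD: "continuous_on S D" for S
    using D by (intro DERIV_continuous_on) auto
  have cont\<phi>: "continuous_on S ?\<phi>" for S
    by (rule DERIV_continuous_on, rule DERIV_std_normal_density)
  have contk: "continuous_on {0..R} k"
    unfolding k_def by (intro continuous_intros cont\<phi> contD continuous_on_subset[OF cont]) auto
  have FD: "(F has_real_derivative k x - ?\<phi> x * (D x / x - b x)\<^sup>2) (at x)" if "x > 0" for x
    unfolding F_def[abs_def] k_def using that
    by (auto intro!: derivative_eq_intros D DERIV_std_normal_density simp: field_simps power2_eq_square)
  have "((\<lambda>x. D x / x) \<longlongrightarrow> b 0) (at 0)"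
    using D[of 0 UNIV] unfolding has_field_derivative_iff by (simp add: D_def)
  moreover have "(D \<longlongrightarrow> D 0) (at 0)" "(?\<phi> \<longlongrightarrow> ?\<phi> 0) (at 0)"
    using contD[of UNIV] cont\<phi>[of UNIV] by (auto simp: continuous_on_def)
  ultimately have "((\<lambda>x. ?\<phi> x * (D x * (D x / x))) \<longlongrightarrow> ?\<phi> 0 * (D 0 * b 0)) (at 0)"
    by (intro tendsto_intros)
  then have F0: "(F \<longlongrightarrow> F 0) (at 0)"
    by (simp add: F_def[abs_def] D_def power2_eq_square)
  have "continuous_on {0..R} F"
    unfolding continuous_on_def
  proof
    fix x assume "x \<in> {0..R}"
    then consider "x = 0" | "x > 0" by fastforce
    then show "(F \<longlongrightarrow> F x) (at x within {0..R})"
    proof cases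
      case 1
      then show ?thesis using tendsto_within_subset[OF F0 subset_UNIV] by simp
    next
      case 2
      from DERIV_isCont[OF FD[OF this]] show ?thesis
        by (auto simp: isCont_def intro: tendsto_within_subset)
    qed
  qed
  \<comment> \<open>The derivative is needed only in the interior; at the removable singularity 0
    continuity of \<open>F\<close> is enough.\<close>
  then have "((\<lambda>x. k x - ?\<phi> x * (D x / x - b x)\<^sup>2) has_integral F R - F 0) {0..R}"
    using R FD by (intro fundamental_theorem_of_calculus_interior)
      (auto simp flip: has_real_derivative_iff_has_vector_derivative)
  then have "F R - F 0 \<le> integral {0..R} k"
    using integrable_continuous_interval[OF contk]
    by (intro has_integral_le[OF _ integrable_integral]) auto
  moreover have "F R \<ge> 0" "F 0 = 0" using R by (auto simp: F_def)
  ultimately show ?thesis by (simp add: k_def[abs_def] D_def)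
qed

lemma gauss_poincare:
  fixes g b :: "real \<Rightarrow> real"
  assumes quad: "\<And>x y. \<bar>g y - g x - b x * (y - x)\<bar> \<le> K * (y - x)\<^sup>2"
    and bound: "\<And>x. \<bar>b x\<bar> \<le> B"
  shows "(\<integral>x. (g x)\<^sup>2 \<partial>gauss) \<le> (\<integral>x. g x \<partial>gauss)\<^sup>2 + (\<integral>x. (b x)\<^sup>2 \<partial>gauss)"
proof -
  let ?\<phi> = std_normal_density
  have deriv: "(g has_real_derivative b x) (at x)" for x
    by (rule DERIV_quadratic_remainder[OF quad])
  have contg: "continuous_on UNIV g"
    using deriv by (intro DERIV_continuous_on)
  \<comment> \<open>Adding the remainder bounds at (x, y) and (y, x) cancels the values of
    \<open>g\<close> and leaves the increment of \<open>b\<close>. This gives the continuity of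
    \<open>b\<close> that \<open>gauss_hardy_half\<close> asks for.\<close>
  have "\<bar>b y - b x\<bar> \<le> 2 * K * \<bar>y - x\<bar>" for x y
  proof (cases "x = y")
    case False
    have "\<bar>b y - b x\<bar> * \<bar>y - x\<bar> = \<bar>(b y - b x) * (y - x)\<bar>" by (simp add: abs_mult)
    also have "\<dots> = \<bar>(g x - g y - b y * (x - y)) + (g y - g x - b x * (y - x))\<bar>"
      by (simp add: algebra_simps)
    also have "\<dots> \<le> K * (x - y)\<^sup>2 + K * (y - x)\<^sup>2"
      using quad[of x y] quad[of y x] by linarith
    also have "\<dots> = (2 * K * \<bar>y - x\<bar>) * \<bar>y - x\<bar>"
      by (simp add: power2_commute[of x y]) (simp add: power2_eq_square)
    finally show ?thesis using False by simp
  qed simp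
  then have "(2 * K)-lipschitz_on UNIV b" if "K \<ge> 0"
    using that by (intro lipschitz_onI) (auto simp: dist_real_def abs_minus_commute)
  moreover have "K \<ge> 0" using quad[of 1 0] abs_ge_zero[of "g 1 - g 0 - b 0"] by simp
  ultimately have contb: "continuous_on UNIV b"
    by (auto intro: lipschitz_on_continuous_on)
  have B: "B \<ge> 0" using bound[of 0] by simp
  have D: "\<bar>g x - g 0\<bar> \<le> B * \<bar>x\<bar>" for x
    using field_differentiable_bound[of UNIV g b B x 0] deriv bound by simp
  have [measurable]: "g \<in> borel_measurable borel" "b \<in> borel_measurable borel"
    using contg contb by (auto intro: borel_measurable_continuous_onI)
  have sq: "x\<^sup>2 \<le> 2 * exp \<bar>x\<bar>" for x :: real
    using exp_lower_Taylor_quadratic[of "\<bar>x\<bar>"] by simp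
  have i1: "integrable gauss (\<lambda>x. (g x - g 0)\<^sup>2)"
  proof (rule integrable_gauss_bound[where A = "2 * B\<^sup>2" and B = 1])
    fix x
    have "(g x - g 0)\<^sup>2 \<le> (B * \<bar>x\<bar>)\<^sup>2" using D[of x] by (metis abs_ge_zero power2_abs power_mono)
    also have "\<dots> \<le> B\<^sup>2 * (2 * exp \<bar>x\<bar>)" using sq[of x] by (simp add: power_mult_distrib mult_left_mono)
    finally show "\<bar>(g x - g 0)\<^sup>2\<bar> \<le> 2 * B\<^sup>2 * exp (1 * \<bar>x\<bar>)" by simp
  qed simp
  have i2: "integrable gauss (\<lambda>x. (b x)\<^sup>2)"
    using bound by (intro gauss.integrable_const_bound[of _ "B\<^sup>2"] AE_I2)
      (auto simp: power2_le_iff_abs_le B measurable_cong_sets[OF sets_gauss refl])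
  have i3: "integrable gauss (\<lambda>x. g x - g 0)"
    by (rule gauss.square_integrable_imp_integrable[OF _ i1]) measurable
  define k where "k x = ?\<phi> x * ((b x)\<^sup>2 - (g x - g 0)\<^sup>2)" for x
  have k: "integrable lborel k"
    using integral_gauss(2)[of "\<lambda>x. (b x)\<^sup>2 - (g x - g 0)\<^sup>2"] i1 i2 by (simp add: k_def[abs_def])
  have cont\<phi>: "continuous_on S ?\<phi>" for S
    by (rule DERIV_continuous_on, rule DERIV_std_normal_density)
  have contk: "continuous_on UNIV k"
    unfolding k_def by (intro continuous_intros cont\<phi> contg contb)
  \<comment> \<open>\<open>Suc m\<close> keeps the radius positive. The negative half-line is
    handled by reflecting \<open>g\<close>: the derivative changes sign, but only its square
    occurs.\<close>
  have pos: "0 \<le> (\<integral>x. indicator {- real (Suc m)..real (Suc m)} x *\<^sub>R k x \<partial>lborel)" for m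
  proof -
    let ?R = "real (Suc m)"
    have int: "k integrable_on {c..d}" for c d
      by (intro integrable_continuous_interval continuous_on_subset[OF contk]) auto
    have 1: "0 \<le> integral {0..?R} k"
      unfolding k_def by (intro gauss_hardy_half deriv contb) simp
    have d: "((\<lambda>x. g (- x)) has_real_derivative - b (- x)) (at x)" for x
      using DERIV_chain'[OF DERIV_minus[OF DERIV_ident] deriv] by simp
    have "continuous_on UNIV (\<lambda>x. - b (- x))"
      by (intro continuous_intros continuous_on_compose2[OF contb]) auto
    from gauss_hardy_half[OF d this, of ?R]
    have 2: "0 \<le> integral {0..?R} (\<lambda>x. k (- x))"
      by (simp add: k_def std_normal_density_def)
    have "integral {0..?R} (\<lambda>x. k (- x)) = integral {- ?R..0} k"
      using Henstock_Kurzweil_Integration.integral_reflect_real[where a = "- ?R" and b = 0 and f = k] by (simp add: add.commute)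
    then have "0 \<le> integral {- ?R..0} k + integral {0..?R} k" using 1 2 by simp
    also have "\<dots> = integral {- ?R..?R} k"
      by (intro Henstock_Kurzweil_Integration.integral_combine int) auto
    also have "\<dots> = (LINT x:{- ?R..?R}|lborel. k x)"
      by (rule set_borel_integral_eq_integral(2)[symmetric, unfolded set_integrable_def],
          rule integrable_mult_indicator[OF _ k]) simp
    finally show ?thesis by (simp add: set_lebesgue_integral_def)
  qed
  have "(\<lambda>m. \<integral>x. indicator {- real (Suc m)..real (Suc m)} x *\<^sub>R k x \<partial>lborel) \<longlonglongrightarrow> (\<integral>x. k x \<partial>lborel)"
  proof (rule integral_dominated_convergence[where w = "\<lambda>x. norm (k x)"])
    show "AE x in lborel. (\<lambda>m. indicator {- real (Suc m)..real (Suc m)} x *\<^sub>R k x) \<longlonglongrightarrow> k x"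
    proof (rule AE_I2)
      fix x
      have "\<forall>\<^sub>F m in sequentially. indicator {- real (Suc m)..real (Suc m)} x *\<^sub>R k x = k x"
        using eventually_ge_at_top[of "nat \<lceil>\<bar>x\<bar>\<rceil>"]
      proof eventually_elim
        case (elim m)
        then have "\<bar>x\<bar> \<le> real (Suc m)" by linarith
        then show ?case by (auto simp: indicator_def)
      qed
      then show "(\<lambda>m. indicator {- real (Suc m)..real (Suc m)} x *\<^sub>R k x) \<longlonglongrightarrow> k x"
        by (rule tendsto_eventually)
    qed
  qed (use k in \<open>auto split: split_indicator\<close>)
  then have "0 \<le> (\<integral>x. k x \<partial>lborel)"
    using pos by (intro LIMSEQ_le_const) auto
  also have "\<dots> = (\<integral>x. (b x)\<^sup>2 - (g x - g 0)\<^sup>2 \<partial>gauss)"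
    by (simp add: integral_gauss k_def)
  finally have "(\<integral>x. (g x - g 0)\<^sup>2 \<partial>gauss) \<le> (\<integral>x. (b x)\<^sup>2 \<partial>gauss)"
    using i1 i2 by simp
  moreover have "(\<integral>x. (g x)\<^sup>2 \<partial>gauss) = (\<integral>x. (g x - g 0)\<^sup>2 + 2 * g 0 * (g x - g 0) + (g 0)\<^sup>2 \<partial>gauss)"
    by (simp add: power2_eq_square algebra_simps)
  then have "(\<integral>x. (g x)\<^sup>2 \<partial>gauss) = (\<integral>x. (g x - g 0)\<^sup>2 \<partial>gauss) + 2 * g 0 * (\<integral>x. g x - g 0 \<partial>gauss) + (g 0)\<^sup>2"
    using i1 i3 gauss.prob_space by simp
  moreover have "(\<integral>x. g x \<partial>gauss) = (\<integral>x. (g x - g 0) + g 0 \<partial>gauss)" by simp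
  then have "(\<integral>x. g x \<partial>gauss) = (\<integral>x. g x - g 0 \<partial>gauss) + g 0"
    using i3 gauss.prob_space by (subst (asm) Bochner_Integration.integral_add) auto
  \<comment> \<open>Return from the centre \<open>g 0\<close> to the mean: with c = E (g - g 0) the
    squared mean exceeds 2 (g 0) c + (g 0)^2 by c^2, which is dropped.\<close>
  moreover have "a + 2 * g 0 * c + (g 0)\<^sup>2 \<le> (c + g 0)\<^sup>2 + d" if "a \<le> d" for a c d
    using that by (simp add: power2_sum add_increasing)
  ultimately show ?thesis by simp
qed

section \<open>The Poincare inequality in n dimensions\<close>

lemma integrable_std_gaussian_square_bound:
  fixes h :: "(nat \<Rightarrow> real) \<Rightarrow> real" and A :: real
  assumes [measurable]: "h \<in> borel_measurable (std_gaussian n)"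
    and bound: "\<And>x. x \<in> Rn n \<Longrightarrow> \<bar>h x\<bar> \<le> A * exp (B * (\<Sum>i<n. \<bar>x i\<bar>))"
  shows "integrable (std_gaussian n) (\<lambda>x. (h x)\<^sup>2)"
proof (rule integrable_std_gaussian_bound[where A = "A\<^sup>2" and B = "2 * B"])
  fix x assume "x \<in> Rn n"
  from power_mono[OF bound[OF this], of 2]
  show "\<bar>(h x)\<^sup>2\<bar> \<le> A\<^sup>2 * exp (2 * B * (\<Sum>i<n. \<bar>x i\<bar>))"
    by (simp add: power_mult_distrib flip: exp_of_nat_mult mult.assoc)
qed measurable

lemma std_gaussian_integral_Suc:
  fixes h :: "(nat \<Rightarrow> real) \<Rightarrow> real"
  assumes "integrable (std_gaussian (Suc n)) h"
  shows "(\<integral>x. h x \<partial>std_gaussian (Suc n)) = (\<integral>x. (\<integral>t. h (x(n := t)) \<partial>gauss) \<partial>std_gaussian n)"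
  using assms gauss_prod.product_integral_insert[of "{..<n}" n h]
  by (simp add: std_gaussian_PiM lessThan_Suc)

lemma measurable_std_gaussian_update:
  "(\<lambda>p. (fst p)(n := snd p)) \<in> measurable (std_gaussian n \<Otimes>\<^sub>M gauss) (std_gaussian (Suc n))"
  using measurable_add_dim[of n "{..<n}" "\<lambda>_. gauss"]
  by (simp add: std_gaussian_PiM lessThan_Suc case_prod_beta')

lemma measurable_std_gaussian_integral_last:
  fixes h :: "(nat \<Rightarrow> real) \<Rightarrow> real"
  assumes [measurable]: "h \<in> borel_measurable (std_gaussian (Suc n))"
  shows "(\<lambda>x. \<integral>t. h (x(n := t)) \<partial>gauss) \<in> borel_measurable (std_gaussian n)"
proof (rule gauss.borel_measurable_lebesgue_integral)
  have "(\<lambda>p. h ((fst p)(n := snd p))) \<in> borel_measurable (std_gaussian n \<Otimes>\<^sub>M gauss)"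
    by (rule measurable_compose[OF measurable_std_gaussian_update assms])
  then show "(\<lambda>(x, t). h (x(n := t))) \<in> borel_measurable (std_gaussian n \<Otimes>\<^sub>M gauss)"
    by (simp add: case_prod_beta')
qed

lemma Rn_update: "x \<in> Rn n \<Longrightarrow> i < n \<Longrightarrow> x(i := t) \<in> Rn n"
  by (auto simp: Rn_def PiE_iff extensional_def)

lemma Rn_update_Suc: "x \<in> Rn n \<Longrightarrow> x(n := t) \<in> Rn (Suc n)"
  by (auto simp: Rn_def PiE_iff extensional_def)

lemma measurable_std_gaussian_last:
  fixes h :: "(nat \<Rightarrow> real) \<Rightarrow> real"
  assumes "h \<in> borel_measurable (std_gaussian (Suc n))" "x \<in> Rn n"
  shows "(\<lambda>t. h (x(n := t))) \<in> borel_measurable gauss"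
proof -
  have "(\<lambda>t. (x, t)) \<in> measurable gauss (std_gaussian n \<Otimes>\<^sub>M gauss)"
    using assms(2) by (simp add: space_std_gaussian)
  from measurable_compose[OF measurable_compose[OF this measurable_std_gaussian_update] assms(1)]
  show ?thesis by simp
qed

text \<open>Induction on the dimension: the variance is that of the average over the last coordinate
  plus the average of the variances in that coordinate. The averages \<open>g'\<close> and
  \<open>b'\<close> inherit the hypotheses with the same \<open>B\<close> and \<open>K\<close>,
  without differentiation under the integral sign. Only the growth constant changes, by the factor
  \<open>E\<close>, which is why \<open>A\<close> is generalised.\<close>

lemma std_gaussian_poincare:
  fixes g :: "(nat \<Rightarrow> real) \<Rightarrow> real" and b :: "nat \<Rightarrow> (nat \<Rightarrow> real) \<Rightarrow> real" and A B K :: real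
  assumes "g \<in> borel_measurable (std_gaussian n)"
    and "\<And>i. i < n \<Longrightarrow> b i \<in> borel_measurable (std_gaussian n)"
    and "\<And>x. x \<in> Rn n \<Longrightarrow> \<bar>g x\<bar> \<le> A * exp (\<Sum>i<n. \<bar>x i\<bar>)"
    and "\<And>x i. x \<in> Rn n \<Longrightarrow> i < n \<Longrightarrow> \<bar>b i x\<bar> \<le> B"
    and "\<And>x i t. x \<in> Rn n \<Longrightarrow> i < n \<Longrightarrow> \<bar>g (x(i := t)) - g x - b i x * (t - x i)\<bar> \<le> K * (t - x i)\<^sup>2"
  shows "(\<integral>x. (g x)\<^sup>2 \<partial>std_gaussian n)
    \<le> (\<integral>x. g x \<partial>std_gaussian n)\<^sup>2 + (\<Sum>i<n. \<integral>x. (b i x)\<^sup>2 \<partial>std_gaussian n)"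
  using assms
proof (induction n arbitrary: g b A)
  case 0
  have sp: "space (std_gaussian 0) = {\<lambda>_. undefined}"
    by (simp add: space_std_gaussian Rn_def)
  have "(\<integral>x. h x \<partial>std_gaussian 0) = h (\<lambda>_. undefined)" for h :: "(nat \<Rightarrow> real) \<Rightarrow> real"
  proof -
    have "(\<integral>x. h x \<partial>std_gaussian 0) = (\<integral>x. h (\<lambda>_. undefined) \<partial>std_gaussian 0)"
      by (rule Bochner_Integration.integral_cong) (auto simp: sp)
    then show ?thesis using std_gaussian.prob_space[of 0] by simp
  qed
  then show ?case by simp
next
  case (Suc n)
  note [measurable] = Suc.prems(1,2)
  note growth = Suc.prems(3) and bound = Suc.prems(4) and quad = Suc.prems(5)
  let ?G = "std_gaussian n" and ?G' = "std_gaussian (Suc n)"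
  define g' where "g' x = (\<integral>t. g (x(n := t)) \<partial>gauss)" for x
  define b' where "b' i x = (\<integral>t. b i (x(n := t)) \<partial>gauss)" for i x
  define E where "E = (\<integral>t. exp \<bar>t\<bar> \<partial>gauss)"
  have upd: "x(n := t) \<in> Rn (Suc n)" if "x \<in> Rn n" for x t
    using that by (rule Rn_update_Suc)
  have growth': "\<bar>g (x(n := t))\<bar> \<le> A * exp (\<Sum>i<n. \<bar>x i\<bar>) * exp \<bar>t\<bar>" if "x \<in> Rn n" for x t
  proof -
    have "(\<Sum>i<Suc n. \<bar>(x(n := t)) i\<bar>) = (\<Sum>i<n. \<bar>x i\<bar>) + \<bar>t\<bar>" by simp
    with growth[OF upd[OF that, of t]] show ?thesis by (simp only: exp_add mult.assoc)
  qed
  have bound': "\<bar>b i (x(n := t))\<bar> \<le> B" if "x \<in> Rn n" "i < Suc n" for x i t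
    by (rule bound[OF upd[OF that(1)] that(2)])
  have ig: "integrable gauss (\<lambda>t. g (x(n := t)))" if "x \<in> Rn n" for x
    using integrable_gauss_bound[of "\<lambda>t. g (x(n := t))" "A * exp (\<Sum>i<n. \<bar>x i\<bar>)" 1]
      growth'[OF that] measurable_std_gaussian_last[OF Suc.prems(1) that]
    by (simp add: measurable_cong_sets[OF sets_gauss refl])
  have ib: "integrable gauss (\<lambda>t. b i (x(n := t)))" "integrable gauss (\<lambda>t. (b i (x(n := t)))\<^sup>2)"
    if "x \<in> Rn n" "i < Suc n" for x i
  proof -
    have [measurable]: "(\<lambda>t. b i (x(n := t))) \<in> borel_measurable gauss"
      by (rule measurable_std_gaussian_last[OF Suc.prems(2)[OF that(2)] that(1)])
    show "integrable gauss (\<lambda>t. b i (x(n := t)))"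
      using bound'[OF that]
      by (intro gauss.integrable_const_bound[where B = B]) auto
    have "(b i (x(n := t)))\<^sup>2 \<le> B\<^sup>2" for t
      using bound'[OF that, of t] by (metis abs_ge_zero power2_abs power_mono)
    then show "integrable gauss (\<lambda>t. (b i (x(n := t)))\<^sup>2)"
      by (intro gauss.integrable_const_bound[where B = "B\<^sup>2"]) auto
  qed
  have b2: "(b i x)\<^sup>2 \<le> B\<^sup>2" if "x \<in> Rn (Suc n)" "i < Suc n" for x i
    using bound[OF that] by (metis abs_ge_zero power2_abs power_mono)
  have b2': "(b i (x(n := t)))\<^sup>2 \<le> B\<^sup>2" if "x \<in> Rn n" "i < Suc n" for x i t
    by (rule b2[OF upd[OF that(1)] that(2)])
  have iG: "integrable ?G' g"
    using growth by (intro integrable_std_gaussian_bound[where A = A and B = 1]) auto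
  have iG2: "integrable ?G' (\<lambda>x. (g x)\<^sup>2)"
    using growth by (intro integrable_std_gaussian_square_bound[where A = A and B = 1]) auto
  have iB2: "integrable ?G' (\<lambda>x. (b i x)\<^sup>2)" if "i < Suc n" for i
    using b2[OF _ that] that
    by (intro std_gaussian.integrable_const_bound[where B = "B\<^sup>2"]) (auto simp: space_std_gaussian)
  have mg': "g' \<in> borel_measurable ?G"
    unfolding g'_def[abs_def] by (rule measurable_std_gaussian_integral_last[OF Suc.prems(1)])
  have mb': "b' i \<in> borel_measurable ?G" if "i < Suc n" for i
    unfolding b'_def[abs_def] by (rule measurable_std_gaussian_integral_last[OF Suc.prems(2)[OF that]])
  have growth_g': "\<bar>g' x\<bar> \<le> A * E * exp (\<Sum>i<n. \<bar>x i\<bar>)" if "x \<in> Rn n" for x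
  proof -
    have "\<bar>g' x\<bar> \<le> (\<integral>t. \<bar>g (x(n := t))\<bar> \<partial>gauss)"
      unfolding g'_def by (rule integral_abs_bound)
    also have "\<dots> \<le> (\<integral>t. A * exp (\<Sum>i<n. \<bar>x i\<bar>) * exp \<bar>t\<bar> \<partial>gauss)"
      using growth'[OF that] ig[OF that] integrable_gauss_exp_abs[of 1]
      by (intro integral_mono) auto
    finally show ?thesis by (simp add: E_def mult_ac)
  qed
  have bound_b': "\<bar>b' i x\<bar> \<le> B" if "x \<in> Rn n" "i < Suc n" for x i
  proof -
    have "\<bar>b' i x\<bar> \<le> (\<integral>t. \<bar>b i (x(n := t))\<bar> \<partial>gauss)"
      unfolding b'_def by (rule integral_abs_bound)
    also have "\<dots> \<le> (\<integral>t. B \<partial>gauss)"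
      using bound'[OF that] ib[OF that]
      by (intro integral_mono) auto
    finally show ?thesis using gauss.prob_space by simp
  qed
  have quad': "\<bar>g' (x(i := t)) - g' x - b' i x * (t - x i)\<bar> \<le> K * (t - x i)\<^sup>2"
    if x: "x \<in> Rn n" and i: "i < n" for x i t
  proof -
    let ?r = "\<lambda>s. g (x(n := s, i := t)) - g (x(n := s)) - b i (x(n := s)) * (t - x i)"
    have sw: "x(i := t, n := s) = x(n := s, i := t)" for s
      using i by (auto simp: fun_upd_def)
    have xi: "(x(n := s)) i = x i" for s
      using i by simp
    have ir: "integrable gauss (\<lambda>s. g (x(n := s, i := t)))"
      using ig[OF Rn_update[OF x i, of t]] by (simp add: sw)
    have int_r: "integrable gauss ?r"
      by (intro Bochner_Integration.integrable_diff integrable_mult_left ir ig ib x less_SucI i)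
    have eq: "g' (x(i := t)) - g' x - b' i x * (t - x i) = (\<integral>s. ?r s \<partial>gauss)"
      unfolding g'_def b'_def sw
      by (simp add: ir ig[OF x] ib[OF x less_SucI[OF i]])
    have "\<bar>\<integral>s. ?r s \<partial>gauss\<bar> \<le> (\<integral>s. \<bar>?r s\<bar> \<partial>gauss)" by (rule integral_abs_bound)
    also have "\<dots> \<le> (\<integral>s. K * (t - x i)\<^sup>2 \<partial>gauss)"
    proof (rule integral_mono)
      fix s
      show "\<bar>?r s\<bar> \<le> K * (t - x i)\<^sup>2"
        using quad[OF upd[OF x, of s] less_SucI[OF i], of t] unfolding xi .
    qed (intro integrable_abs int_r, simp)
    also have "\<dots> = K * (t - x i)\<^sup>2" using gauss.prob_space by simp
    finally show ?thesis unfolding eq .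
  qed
  have IH: "(\<integral>x. (g' x)\<^sup>2 \<partial>?G) \<le> (\<integral>x. g' x \<partial>?G)\<^sup>2 + (\<Sum>i<n. \<integral>x. (b' i x)\<^sup>2 \<partial>?G)"
    by (rule Suc.IH[OF mg' mb'[OF less_SucI] growth_g' bound_b'[OF _ less_SucI] quad'])
  have last: "(\<integral>t. (g (x(n := t)))\<^sup>2 \<partial>gauss) \<le> (g' x)\<^sup>2 + (\<integral>t. (b n (x(n := t)))\<^sup>2 \<partial>gauss)"
    if x: "x \<in> Rn n" for x
    unfolding g'_def
  proof (rule gauss_poincare)
    show "\<bar>g (x(n := t)) - g (x(n := s)) - b n (x(n := s)) * (t - s)\<bar> \<le> K * (t - s)\<^sup>2" for s t
      using quad[OF upd[OF x, of s] lessI, of t] by (simp only: fun_upd_upd fun_upd_same)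
    show "\<bar>b n (x(n := t))\<bar> \<le> B" for t
      using bound'[OF x] by simp
  qed
  have ig'2: "integrable ?G (\<lambda>x. (g' x)\<^sup>2)"
    using growth_g' mg' by (intro integrable_std_gaussian_square_bound[where A = "A * E" and B = 1]) auto
  have b'2: "(b' i x)\<^sup>2 \<le> B\<^sup>2" if "x \<in> Rn n" "i < Suc n" for x i
    using bound_b'[OF that] by (metis abs_ge_zero power2_abs power_mono)
  have ib'2: "integrable ?G (\<lambda>x. (b' i x)\<^sup>2)" if "i < Suc n" for i
    using b'2[OF _ that] mb'[OF that]
    by (intro std_gaussian.integrable_const_bound[where B = "B\<^sup>2"]) (auto simp: space_std_gaussian)
  have iBl: "integrable ?G (\<lambda>x. \<integral>t. (b i (x(n := t)))\<^sup>2 \<partial>gauss)" if i: "i < Suc n" for i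
  proof (rule std_gaussian.integrable_const_bound[where B = "B\<^sup>2"])
    show "AE x in ?G. norm (\<integral>t. (b i (x(n := t)))\<^sup>2 \<partial>gauss) \<le> B\<^sup>2"
    proof (rule AE_I2)
      fix x assume "x \<in> space ?G"
      then have x: "x \<in> Rn n" by (simp add: space_std_gaussian)
      have "(\<integral>t. (b i (x(n := t)))\<^sup>2 \<partial>gauss) \<le> (\<integral>t. B\<^sup>2 \<partial>gauss)"
        using b2'[OF x i] ib[OF x i] by (intro integral_mono) auto
      then show "norm (\<integral>t. (b i (x(n := t)))\<^sup>2 \<partial>gauss) \<le> B\<^sup>2"
        using gauss.prob_space by simp
    qed
    show "(\<lambda>x. \<integral>t. (b i (x(n := t)))\<^sup>2 \<partial>gauss) \<in> borel_measurable ?G"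
      using i by (intro measurable_std_gaussian_integral_last) measurable
  qed
  have igl: "integrable ?G (\<lambda>x. \<integral>t. (g (x(n := t)))\<^sup>2 \<partial>gauss)"
  proof (rule Bochner_Integration.integrable_bound)
    show "integrable ?G (\<lambda>x. (g' x)\<^sup>2 + (\<integral>t. (b n (x(n := t)))\<^sup>2 \<partial>gauss))"
      using ig'2 iBl by simp
    show "(\<lambda>x. \<integral>t. (g (x(n := t)))\<^sup>2 \<partial>gauss) \<in> borel_measurable ?G"
      by (intro measurable_std_gaussian_integral_last) measurable
  qed (use last in \<open>auto simp: space_std_gaussian intro!: AE_I2 order_trans[OF _ abs_ge_self]\<close>)
  have "(\<integral>x. (g x)\<^sup>2 \<partial>?G') = (\<integral>x. (\<integral>t. (g (x(n := t)))\<^sup>2 \<partial>gauss) \<partial>?G)"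
    by (rule std_gaussian_integral_Suc[OF iG2])
  also have "\<dots> \<le> (\<integral>x. (g' x)\<^sup>2 + (\<integral>t. (b n (x(n := t)))\<^sup>2 \<partial>gauss) \<partial>?G)"
    using igl ig'2 iBl last by (intro integral_mono) (auto simp: space_std_gaussian)
  also have "\<dots> = (\<integral>x. (g' x)\<^sup>2 \<partial>?G) + (\<integral>x. (b n x)\<^sup>2 \<partial>?G')"
    using ig'2 iBl by (simp add: std_gaussian_integral_Suc[OF iB2])
  also have "(\<integral>x. (g' x)\<^sup>2 \<partial>?G) \<le> (\<integral>x. g x \<partial>?G')\<^sup>2 + (\<Sum>i<n. \<integral>x. (b i x)\<^sup>2 \<partial>?G')"
  proof -
    have "(\<integral>x. g' x \<partial>?G) = (\<integral>x. g x \<partial>?G')"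
      unfolding g'_def by (rule std_gaussian_integral_Suc[OF iG, symmetric])
    \<comment> \<open>Jensen: averaging over the last coordinate does not increase the gradient
      energy.\<close>
    moreover have "(\<integral>x. (b' i x)\<^sup>2 \<partial>?G) \<le> (\<integral>x. (b i x)\<^sup>2 \<partial>?G')" if "i < n" for i
    proof -
      have "(\<integral>x. (b' i x)\<^sup>2 \<partial>?G) \<le> (\<integral>x. (\<integral>t. (b i (x(n := t)))\<^sup>2 \<partial>gauss) \<partial>?G)"
        using that ib'2 iBl unfolding b'_def
        by (intro integral_mono square_integral_le ib) (auto simp: space_std_gaussian gauss.prob_space_axioms)
      then show ?thesis using that by (simp add: std_gaussian_integral_Suc[OF iB2])
    qed
    ultimately show ?thesis using IH by (auto intro: order_trans[OF _ add_left_mono[OF sum_mono]])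
  qed
  finally show ?case by simp
qed

section \<open>Lipschitz and convex functions\<close>

text \<open>Unlike in \<open>lipschitz_Rn\<close>, the bound ranges over all sequences, so that
  affine combinations need no restriction to \<open>{..<n}\<close>. Its right side sees only the
  coordinates below \<open>n\<close>, which forces \<open>g\<close> to ignore the others.\<close>

definition lipschitz_fun :: "nat \<Rightarrow> real \<Rightarrow> ((nat \<Rightarrow> real) \<Rightarrow> real) \<Rightarrow> bool" where
  "lipschitz_fun n L g \<longleftrightarrow> (\<forall>x y. \<bar>g x - g y\<bar> \<le> L * L2_set (\<lambda>i. x i - y i) {..<n})"

definition convex_fun :: "((nat \<Rightarrow> real) \<Rightarrow> real) \<Rightarrow> bool" where
  "convex_fun g \<longleftrightarrow>
    (\<forall>x y. \<forall>u\<ge>0. \<forall>v\<ge>0. u + v = 1 \<longrightarrow> g (\<lambda>i. u * x i + v * y i) \<le> u * g x + v * g y)"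

lemma lipschitz_funD: "lipschitz_fun n L g \<Longrightarrow> \<bar>g x - g y\<bar> \<le> L * L2_set (\<lambda>i. x i - y i) {..<n}"
  by (simp add: lipschitz_fun_def)

lemma lipschitz_fun_cong:
  assumes "lipschitz_fun n L g" "\<And>i. i < n \<Longrightarrow> x i = y i"
  shows "g x = g y"
proof -
  have "L2_set (\<lambda>i. x i - y i) {..<n} = 0"
    using assms(2) by (subst L2_set_eq_0_iff) auto
  then show ?thesis using lipschitz_funD[OF assms(1), of x y] by simp
qed

lemma lipschitz_fun_restrict: "lipschitz_fun n L g \<Longrightarrow> g (restrict x {..<n}) = g x"
  by (erule lipschitz_fun_cong) simp

text \<open>The seminorm involves finitely many coordinates, each continuous in the product
  topology. The purpose is Borel measurability of \<open>g\<close>.\<close>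

lemma continuous_lipschitz_fun:
  assumes "lipschitz_fun n L g"
  shows "continuous_on UNIV g"
  unfolding continuous_on_def
proof
  fix x
  have "continuous_on UNIV (\<lambda>y. L * L2_set (\<lambda>i. y i - x i) {..<n})"
    unfolding L2_set_def by (intro continuous_intros continuous_on_product_coordinates)
  then have "((\<lambda>y. L * L2_set (\<lambda>i. y i - x i) {..<n}) \<longlongrightarrow> L * L2_set (\<lambda>i. x i - x i) {..<n}) (at x)"
    unfolding continuous_on_def by blast
  then have lim: "((\<lambda>y. L * L2_set (\<lambda>i. y i - x i) {..<n}) \<longlongrightarrow> 0) (at x)"
    by (simp add: L2_set_def)
  have "((\<lambda>y. g y - g x) \<longlongrightarrow> 0) (at x)"
  proof (rule Lim_transform_bound[OF _ lim])
    show "\<forall>\<^sub>F y in at x. norm (g y - g x) \<le> norm (L * L2_set (\<lambda>i. y i - x i) {..<n})"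
      using lipschitz_funD[OF assms, of _ x]
      by (intro always_eventually allI) (metis abs_ge_self order_trans real_norm_def)
  qed
  then show "(g \<longlongrightarrow> g x) (at x)" by (rule LIM_zero_cancel)
qed

text \<open>Coordinates from \<open>n\<close> on can be replaced by 0 without changing
  \<open>g\<close>, so \<open>X\<close> has to be measurable only below \<open>n\<close>.\<close>

lemma measurable_lipschitz_fun:
  assumes g: "lipschitz_fun n L g"
    and X: "\<And>i. i < n \<Longrightarrow> (\<lambda>\<omega>. X \<omega> i) \<in> borel_measurable M"
  shows "(\<lambda>\<omega>. g (X \<omega>)) \<in> borel_measurable M"
proof -
  have "(\<lambda>\<omega> i. if i < n then X \<omega> i else 0) \<in> borel_measurable M"
  proof (rule measurable_coordinatewise_then_product)
    show "(\<lambda>\<omega>. if i < n then X \<omega> i else 0) \<in> borel_measurable M" for i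
      using X by (cases "i < n") auto
  qed
  from measurable_compose[OF this borel_measurable_continuous_onI[OF continuous_lipschitz_fun[OF g]]]
  have "(\<lambda>\<omega>. g (\<lambda>i. if i < n then X \<omega> i else 0)) \<in> borel_measurable M" .
  moreover have "g (\<lambda>i. if i < n then X \<omega> i else 0) = g (X \<omega>)" for \<omega>
    by (rule lipschitz_fun_cong[OF g]) simp
  ultimately show ?thesis by (simp only:)
qed

lemma lipschitz_fun_affine:
  assumes "lipschitz_fun n L g" "r \<ge> 0"
  shows "lipschitz_fun n (L * r) (\<lambda>y. g (\<lambda>i. w i + r * y i))"
  unfolding lipschitz_fun_def
proof (intro allI)
  fix x y
  have "L2_set (\<lambda>i. w i + r * x i - (w i + r * y i)) {..<n} = L2_set (\<lambda>i. r * (x i - y i)) {..<n}"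
    by (simp add: algebra_simps)
  also have "\<dots> = r * L2_set (\<lambda>i. x i - y i) {..<n}"
    using assms(2) by (simp add: L2_set_right_distrib)
  finally show "\<bar>g (\<lambda>i. w i + r * x i) - g (\<lambda>i. w i + r * y i)\<bar> \<le> L * r * L2_set (\<lambda>i. x i - y i) {..<n}"
    using lipschitz_funD[OF assms(1), of "\<lambda>i. w i + r * x i" "\<lambda>i. w i + r * y i"] by simp
qed

lemma convex_fun_affine:
  assumes "convex_fun g"
  shows "convex_fun (\<lambda>y. g (\<lambda>i. w i + r * y i))"
  unfolding convex_fun_def
proof (intro allI impI)
  fix x y and u v :: real assume uv: "u \<ge> 0" "v \<ge> 0" "u + v = 1"
  have "w i = u * w i + v * w i" for i
    using uv(3) by (metis distrib_right mult_1)
  then have "w i + r * (u * x i + v * y i) = u * (w i + r * x i) + v * (w i + r * y i)" for i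
    by (smt (verit, best) distrib_left mult.left_commute)
  then show "g (\<lambda>i. w i + r * (u * x i + v * y i)) \<le> u * g (\<lambda>i. w i + r * x i) + v * g (\<lambda>i. w i + r * y i)"
    using assms uv by (simp add: convex_fun_def)
qed

lemma lipschitz_fun_growth:
  assumes "lipschitz_fun n L g" "L \<ge> 0"
  shows "\<bar>g x\<bar> \<le> (\<bar>g (\<lambda>_. 0)\<bar> + L) * exp (\<Sum>i<n. \<bar>x i\<bar>)"
proof -
  let ?S = "\<Sum>i<n. \<bar>x i\<bar>"
  have "L2_set x {..<n} \<le> ?S" by (rule L2_set_le_sum_abs)
  also have "?S \<le> exp ?S" using exp_ge_add_one_self[of ?S] by linarith
  finally have "L * L2_set x {..<n} \<le> L * exp ?S" using assms(2) by (rule mult_left_mono)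
  moreover have "\<bar>g (\<lambda>_. 0)\<bar> * 1 \<le> \<bar>g (\<lambda>_. 0)\<bar> * exp ?S"
    by (intro mult_left_mono) (auto simp: sum_nonneg)
  ultimately show ?thesis
    using lipschitz_funD[OF assms(1), of x "\<lambda>_. 0"] by (simp add: distrib_right)
qed

lemma measurable_lipschitz_fun_std_gaussian:
  "lipschitz_fun n L g \<Longrightarrow> g \<in> borel_measurable (std_gaussian n)"
  by (rule measurable_lipschitz_fun) (auto intro: measurable_std_gaussian_component)

lemma integrable_lipschitz_fun:
  assumes "lipschitz_fun n L g" "L \<ge> 0"
  shows "integrable (std_gaussian n) g" "integrable (std_gaussian n) (\<lambda>x. (g x)\<^sup>2)"
    "integrable (std_gaussian n) (\<lambda>x. g x * x i)"
proof -
  let ?C = "\<bar>g (\<lambda>_. 0)\<bar> + L"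
  have [measurable]: "g \<in> borel_measurable (std_gaussian n)"
    by (rule measurable_lipschitz_fun_std_gaussian[OF assms(1)])
  have growth: "\<bar>g x\<bar> \<le> ?C * exp (\<Sum>i<n. \<bar>x i\<bar>)" for x
    by (rule lipschitz_fun_growth[OF assms])
  show "integrable (std_gaussian n) g"
    by (rule integrable_std_gaussian_bound[where A = ?C and B = 1]) (use growth in auto)
  show "integrable (std_gaussian n) (\<lambda>x. (g x)\<^sup>2)"
    by (rule integrable_std_gaussian_square_bound[where A = ?C and B = 1]) (use growth in auto)
  show "integrable (std_gaussian n) (\<lambda>x. g x * x i)"
  \<comment> \<open>For i \<ge> n the coordinate \<open>x i\<close> is \<open>undefined\<close>,
    whence the extra factor. The 2 in the exponent collects one exponential for \<open>g\<close> and
    one for \<open>x i\<close>.\<close>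
  proof (rule integrable_std_gaussian_bound[where A = "?C * (1 + \<bar>undefined\<bar>)" and B = 2])
    fix x assume x: "x \<in> Rn n"
    let ?S = "\<Sum>i<n. \<bar>x i\<bar>"
    have S: "?S \<ge> 0" by (simp add: sum_nonneg)
    have e: "?S + 1 \<le> exp ?S" using exp_ge_add_one_self[of ?S] by linarith
    have "\<bar>x i\<bar> \<le> (1 + \<bar>undefined\<bar>) * exp ?S"
    proof (cases "i < n")
      case True
      then have "\<bar>x i\<bar> \<le> ?S" by (intro member_le_sum) auto
      also have "\<dots> \<le> 1 * exp ?S" using e by simp
      also have "\<dots> \<le> (1 + \<bar>undefined\<bar>) * exp ?S" by (intro mult_right_mono) auto
      finally show ?thesis .
    next
      case False
      then have "x i = undefined" using x by (auto simp: Rn_def PiE_iff extensional_def)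
      then have "\<bar>x i\<bar> \<le> (1 + \<bar>undefined\<bar>) * 1" by simp
      also have "\<dots> \<le> (1 + \<bar>undefined\<bar>) * exp ?S" using S by (intro mult_left_mono) auto
      finally show ?thesis .
    qed
    from mult_mono[OF growth this]
    have "\<bar>g x * x i\<bar> \<le> ?C * exp ?S * ((1 + \<bar>undefined\<bar>) * exp ?S)"
      using assms(2) by (simp add: abs_mult)
    also have "\<dots> = ?C * (1 + \<bar>undefined\<bar>) * exp (2 * ?S)"
      by (simp add: mult_exp_exp[of ?S ?S] flip: mult_2)
    finally show "\<bar>g x * x i\<bar> \<le> ?C * (1 + \<bar>undefined\<bar>) * exp (2 * ?S)" .
  qed measurable
qed

text \<open>The translated argument need not be extensional; hence the assumption that
  \<open>H\<close> ignores all coordinates from \<open>n\<close> on.\<close>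

lemma std_gaussian_shift_integral:
  fixes H :: "(nat \<Rightarrow> real) \<Rightarrow> real"
  assumes [measurable]: "H \<in> borel_measurable (std_gaussian n)"
    and H: "\<And>x. H (restrict x {..<n}) = H x"
  shows "(\<integral>y. H (\<lambda>i. y i + h i) \<partial>std_gaussian n)
    = (\<integral>y. exp (\<Sum>i<n. h i * y i - (h i)\<^sup>2 / 2) * H y \<partial>std_gaussian n)"
proof -
  have T: "(\<lambda>y. \<lambda>i\<in>{..<n}. y i + h i) \<in> measurable (std_gaussian n) (std_gaussian n)"
    unfolding measurable_cong_sets[OF refl sets_std_gaussian]
    by (intro measurable_restrict) measurable
  have "(\<integral>y. H (\<lambda>i. y i + h i) \<partial>std_gaussian n)
      = (\<integral>y. H y \<partial>distr (std_gaussian n) (std_gaussian n) (\<lambda>y. \<lambda>i\<in>{..<n}. y i + h i))"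
    by (subst integral_distr[OF T]) (simp_all add: H)
  also have "\<dots> = (\<integral>y. exp (\<Sum>i<n. h i * y i - (h i)\<^sup>2 / 2) * H y \<partial>std_gaussian n)"
    unfolding std_gaussian_shift by (subst integral_real_density) auto
  finally show ?thesis .
qed

text \<open>Bounds difference quotients of the shift density uniformly in the step, as dominated
  convergence demands.\<close>

lemma abs_exp_minus_one_le: "\<bar>exp x - 1\<bar> \<le> \<bar>x\<bar> * exp \<bar>x\<bar>" for x :: real
proof -
  have 1: "1 - x \<le> exp (- x)" "1 + x \<le> exp x" using exp_ge_add_one_self[of "- x"] exp_ge_add_one_self[of x] by auto
  show ?thesis
  proof (cases "x \<ge> 0")
    case True
    have "(1 - x) * exp x \<le> exp (- x) * exp x" using 1 by (intro mult_right_mono) auto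
    then have "exp x - 1 \<le> x * exp x" by (simp add: algebra_simps flip: exp_add)
    then show ?thesis using True by simp
  next
    case False
    have "\<bar>exp x - 1\<bar> = 1 - exp x" using False by simp
    also have "\<dots> \<le> \<bar>x\<bar> * 1" using 1(2) by linarith
    also have "\<dots> \<le> \<bar>x\<bar> * exp \<bar>x\<bar>" by (intro mult_left_mono) auto
    finally show ?thesis .
  qed
qed

text \<open>By convexity, difference quotients of \<open>\<epsilon> \<mapsto> \<integral> g (y + \<epsilon> h)\<close> at \<open>0\<close> are bounded by the one at
  \<open>\<epsilon> = 1\<close>; after a change of variables they converge without any differentiability of \<open>g\<close>.\<close>

lemma std_gaussian_subgradient:
  assumes g: "lipschitz_fun n L g" "L \<ge> 0" "convex_fun g"
  shows "(\<Sum>i<n. h i * (\<integral>y. g y * y i \<partial>std_gaussian n))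
    \<le> (\<integral>y. g (\<lambda>i. y i + h i) \<partial>std_gaussian n) - (\<integral>y. g y \<partial>std_gaussian n)"
proof -
  let ?G = "std_gaussian n"
  define a where "a y = (\<Sum>i<n. h i * y i)" for y
  define c where "c = (\<Sum>i<n. (h i)\<^sup>2 / 2)"
  define M where "M = (\<Sum>i<n. \<bar>h i\<bar>)"
  define S where "S y = (\<Sum>i<n. \<bar>y i\<bar>)" for y :: "nat \<Rightarrow> real"
  define e where "e k = inverse (real (Suc k))" for k
  \<comment> \<open>Difference quotient of the density of the shift by \<open>e k\<close> times
    \<open>h\<close>. The derivative thus falls on the density, with limit \<open>a y\<close>, and
    not on \<open>g\<close>.\<close>
  define q where "q k y = (exp (e k * a y - (e k)\<^sup>2 * c) - 1) / e k" for k y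
  have e: "0 < e k" "e k \<le> 1" for k by (auto simp: e_def inverse_le_1_iff)
  have c: "c \<ge> 0" by (auto simp: c_def intro: sum_nonneg)
  have M: "M \<ge> 0" by (auto simp: M_def intro: sum_nonneg)
  have S: "S y \<ge> 0" for y by (auto simp: S_def intro: sum_nonneg)
  have a_le: "\<bar>a y\<bar> \<le> M * S y" for y
  proof -
    have "\<bar>a y\<bar> \<le> (\<Sum>i<n. \<bar>h i\<bar> * \<bar>y i\<bar>)"
      unfolding a_def by (rule order_trans[OF sum_abs]) (simp add: abs_mult)
    also have "\<dots> \<le> (\<Sum>i<n. M * \<bar>y i\<bar>)"
      unfolding M_def by (intro sum_mono mult_right_mono member_le_sum) auto
    finally show ?thesis by (simp add: S_def sum_distrib_left)
  qed
  have [measurable]: "g \<in> borel_measurable ?G"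
    by (rule measurable_lipschitz_fun_std_gaussian[OF g(1)])
  have [measurable]: "a \<in> borel_measurable ?G"
    unfolding a_def[abs_def] by measurable
  have [measurable]: "q k \<in> borel_measurable ?G" for k
    unfolding q_def[abs_def] by measurable
  note ig = integrable_lipschitz_fun[OF g(1,2)]
  have ish: "integrable ?G (\<lambda>y. g (\<lambda>i. y i + s * h i))" for s
  proof -
    have "lipschitz_fun n (L * 1) (\<lambda>y. g (\<lambda>i. s * h i + 1 * y i))"
      by (rule lipschitz_fun_affine[OF g(1)]) simp
    from integrable_lipschitz_fun(1)[OF this] g(2) show ?thesis by (simp add: add.commute)
  qed
  have q_le: "\<bar>q k y\<bar> \<le> (M * S y + c) * exp (M * S y + c)" for k y
  proof -
    let ?x = "e k * a y - (e k)\<^sup>2 * c"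
    have "\<bar>?x\<bar> \<le> e k * \<bar>a y\<bar> + e k * (e k * c)"
      using abs_triangle_ineq4[of "e k * a y" "(e k)\<^sup>2 * c"] e[of k] c
      by (simp add: abs_mult power2_eq_square mult.assoc)
    also have "\<dots> \<le> e k * (M * S y) + e k * c"
      using e[of k] c a_le[of y] by (intro add_mono mult_left_mono mult_left_le_one_le) auto
    finally have x: "\<bar>?x\<bar> \<le> e k * (M * S y + c)" by (simp add: distrib_left)
    also have "\<dots> \<le> M * S y + c"
      using e[of k] c M S[of y] by (intro mult_left_le_one_le) auto
    finally have "\<bar>?x\<bar> \<le> M * S y + c" .
    then have "\<bar>?x\<bar> * exp \<bar>?x\<bar> \<le> e k * (M * S y + c) * exp (M * S y + c)"
      using x by (intro mult_mono) auto
    then have "\<bar>exp ?x - 1\<bar> \<le> ((M * S y + c) * exp (M * S y + c)) * e k"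
      using abs_exp_minus_one_le[of ?x] by (simp add: mult_ac)
    then show ?thesis
      unfolding q_def using e[of k] by (simp add: abs_divide pos_divide_le_eq)
  qed
  let ?C = "\<bar>g (\<lambda>_. 0)\<bar> + L"
  \<comment> \<open>Majorant of \<open>g y * q k y\<close> for all \<open>k\<close> at once,
    available because \<open>e k\<close> \<le> 1.\<close>
  define w where "w y = \<bar>g y\<bar> * ((M * S y + c) * exp (M * S y + c))" for y
  have iw: "integrable ?G w"
  proof (rule integrable_std_gaussian_bound[where A = "?C * exp (2 * c)" and B = "2 * M + 1"])
    show "w \<in> borel_measurable ?G" unfolding w_def[abs_def] S_def by measurable
    fix y
    let ?T = "M * S y + c"
    have "?T \<le> exp ?T" using exp_ge_add_one_self[of ?T] by linarith
    then have "?T * exp ?T \<le> exp ?T * exp ?T" by (rule mult_right_mono) simp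
    then have 1: "?T * exp ?T \<le> exp (2 * M * S y + 2 * c)" by (simp add: mult_exp_exp algebra_simps)
    have "\<bar>w y\<bar> = \<bar>g y\<bar> * (?T * exp ?T)" using M S c by (simp add: w_def abs_mult)
    also have "\<dots> \<le> ?C * exp (S y) * exp (2 * M * S y + 2 * c)"
      using lipschitz_fun_growth[OF g(1,2), of y] 1 M S[of y] c g(2)
      by (intro mult_mono) (auto simp: S_def)
    also have "\<dots> = ?C * exp (2 * c) * exp ((2 * M + 1) * S y)"
      by (simp add: exp_add algebra_simps)
    finally show "\<bar>w y\<bar> \<le> ?C * exp (2 * c) * exp ((2 * M + 1) * (\<Sum>i<n. \<bar>y i\<bar>))"
      by (simp add: S_def)
  qed
  have lim: "(\<lambda>k. \<integral>y. g y * q k y \<partial>?G) \<longlonglongrightarrow> (\<integral>y. g y * a y \<partial>?G)"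
  proof (rule integral_dominated_convergence[where w = w])
    show "AE y in ?G. (\<lambda>k. g y * q k y) \<longlonglongrightarrow> g y * a y"
    proof (rule AE_I2)
      fix y
      have "((\<lambda>s. exp (s * a y - s\<^sup>2 * c)) has_real_derivative a y) (at 0)"
        by (auto intro!: derivative_eq_intros)
      then have "((\<lambda>s. (exp (s * a y - s\<^sup>2 * c) - 1) / s) \<longlongrightarrow> a y) (at 0)"
        by (simp add: has_field_derivative_iff)
      moreover have "filterlim e (at 0) sequentially"
        unfolding filterlim_at using LIMSEQ_inverse_real_of_nat e
        by (auto simp: e_def[abs_def] less_imp_neq[symmetric])
      ultimately have "(\<lambda>k. q k y) \<longlonglongrightarrow> a y"
        unfolding q_def by (rule filterlim_compose)
      then show "(\<lambda>k. g y * q k y) \<longlonglongrightarrow> g y * a y" by (rule tendsto_mult_left)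
    qed
    show "AE y in ?G. norm (g y * q k y) \<le> w y" for k
      using q_le by (auto simp: w_def abs_mult intro!: AE_I2 mult_left_mono)
  qed (use iw in measurable)
  have le: "(\<integral>y. g y * q k y \<partial>?G) \<le> (\<integral>y. g (\<lambda>i. y i + h i) \<partial>?G) - (\<integral>y. g y \<partial>?G)" for k
  proof -
    let ?I = "\<integral>y. g (\<lambda>i. y i + e k * h i) \<partial>?G"
    \<comment> \<open>The shift by \<open>e k\<close> times \<open>h\<close> is a convex combination
      of no shift and the full shift; this is where convexity enters.\<close>
    have pt: "g (\<lambda>i. y i + e k * h i) \<le> (1 - e k) * g y + e k * g (\<lambda>i. y i + h i)" for y
    proof -
      have "(\<lambda>i. y i + e k * h i) = (\<lambda>i. (1 - e k) * y i + e k * (y i + h i))"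
        by (auto simp: algebra_simps)
      then show ?thesis using g(3) e[of k] by (simp add: convex_fun_def)
    qed
    have "?I \<le> (\<integral>y. (1 - e k) * g y + e k * g (\<lambda>i. y i + h i) \<partial>?G)"
      using ish[of 1] ish ig by (intro integral_mono pt) auto
    then have 1: "?I \<le> (1 - e k) * (\<integral>y. g y \<partial>?G) + e k * (\<integral>y. g (\<lambda>i. y i + h i) \<partial>?G)"
      using ish[of 1] ig by simp
    have ex: "exp (\<Sum>i<n. e k * h i * y i - (e k * h i)\<^sup>2 / 2) = 1 + e k * q k y" for y
    proof -
      have "(\<Sum>i<n. e k * h i * y i - (e k * h i)\<^sup>2 / 2) = e k * a y - (e k)\<^sup>2 * c"
        by (simp add: a_def c_def sum_subtractf sum_distrib_left power_mult_distrib mult.assoc)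
      then show ?thesis using e[of k] by (simp add: q_def)
    qed
    have iq: "integrable ?G (\<lambda>y. g y * q k y)"
    proof (rule Bochner_Integration.integrable_bound[OF iw])
      have "\<bar>g y * q k y\<bar> \<le> w y" for y
        unfolding w_def abs_mult by (rule mult_left_mono[OF q_le abs_ge_zero])
      then show "AE y in ?G. norm (g y * q k y) \<le> norm (w y)"
        by (auto intro!: AE_I2 order_trans[OF _ abs_ge_self])
    qed measurable
    have "?I = (\<integral>y. (1 + e k * q k y) * g y \<partial>?G)"
      by (subst std_gaussian_shift_integral) (auto simp: ex lipschitz_fun_restrict[OF g(1)])
    also have "\<dots> = (\<integral>y. g y + e k * (g y * q k y) \<partial>?G)" by (simp add: algebra_simps)
    also have "\<dots> = (\<integral>y. g y \<partial>?G) + e k * (\<integral>y. g y * q k y \<partial>?G)" using ig iq by simp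
    finally have "e k * (\<integral>y. g y * q k y \<partial>?G) \<le> e k * ((\<integral>y. g (\<lambda>i. y i + h i) \<partial>?G) - (\<integral>y. g y \<partial>?G))"
      using 1 by (simp add: algebra_simps)
    then show ?thesis using e[of k] by simp
  qed
  have "(\<integral>y. g y * a y \<partial>?G) \<le> (\<integral>y. g (\<lambda>i. y i + h i) \<partial>?G) - (\<integral>y. g y \<partial>?G)"
    by (rule LIMSEQ_le_const2[OF lim]) (use le in auto)
  moreover have "(\<integral>y. g y * a y \<partial>?G) = (\<integral>y. (\<Sum>i<n. h i * (g y * y i)) \<partial>?G)"
    by (simp add: a_def sum_distrib_left mult_ac)
  moreover have "\<dots> = (\<Sum>i<n. h i * (\<integral>y. g y * y i \<partial>?G))"
    using ig(3) by (subst Bochner_Integration.integral_sum) auto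
  ultimately show ?thesis by simp
qed

section \<open>Gaussian smoothing\<close>

lemma std_gaussian_second_moment:
  assumes "i < n"
  shows "integrable (std_gaussian n) (\<lambda>x. (x i)\<^sup>2)" "(\<integral>x. (x i)\<^sup>2 \<partial>std_gaussian n) = 1"
proof -
  have d: "distr (std_gaussian n) gauss (\<lambda>x. x i) = gauss"
    unfolding std_gaussian_PiM using assms prob_space_gauss by (intro distr_PiM_component) auto
  have m: "(\<lambda>x. x i) \<in> measurable (std_gaussian n) gauss"
    using measurable_std_gaussian_component[of i n] measurable_cong_sets[OF refl sets_gauss, of "std_gaussian n"]
    by blast
  have sq: "(\<lambda>t. t\<^sup>2) \<in> borel_measurable gauss" by measurable
  have 1: "integrable gauss (\<lambda>t. t\<^sup>2)" "(\<integral>t. t\<^sup>2 \<partial>gauss) = 1"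
    using integrable_std_normal_moment[of 2] integral_std_normal_moment_even[of 1]
    by (simp_all add: integral_gauss)
  show "integrable (std_gaussian n) (\<lambda>x. (x i)\<^sup>2)"
    using integrable_distr_eq[OF m sq] 1 d by simp
  show "(\<integral>x. (x i)\<^sup>2 \<partial>std_gaussian n) = 1"
    using integral_distr[OF m sq] 1 d by simp
qed

lemma std_gaussian_first_abs_moment:
  assumes "i < n"
  shows "integrable (std_gaussian n) (\<lambda>x. \<bar>x i\<bar>)" "(\<integral>x. \<bar>x i\<bar> \<partial>std_gaussian n) \<le> 1"
proof -
  have m: "(\<lambda>x. \<bar>x i\<bar>) \<in> borel_measurable (std_gaussian n)"
    using measurable_std_gaussian_component by measurable
  have sq: "integrable (std_gaussian n) (\<lambda>x. \<bar>x i\<bar>\<^sup>2)"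
    using std_gaussian_second_moment(1)[OF assms] by simp
  show int: "integrable (std_gaussian n) (\<lambda>x. \<bar>x i\<bar>)"
    by (rule std_gaussian.square_integrable_imp_integrable[OF m sq])
  have "(\<integral>x. \<bar>x i\<bar> \<partial>std_gaussian n)\<^sup>2 \<le> 1"
    using square_integral_le[OF prob_space_std_gaussian int sq] std_gaussian_second_moment(2)[OF assms] by simp
  then show "(\<integral>x. \<bar>x i\<bar> \<partial>std_gaussian n) \<le> 1"
    using power2_le_imp_le[of "\<integral>x. \<bar>x i\<bar> \<partial>std_gaussian n" 1] by simp
qed

lemma std_gaussian_convolution_integral:
  fixes H :: "(nat \<Rightarrow> real) \<Rightarrow> real"
  assumes ab: "a\<^sup>2 + b\<^sup>2 = 1" "a \<ge> 0" "b \<ge> 0"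
    and int: "integrable (std_gaussian n) H"
    and H: "\<And>x. H (restrict x {..<n}) = H x"
  shows "integrable (std_gaussian n \<Otimes>\<^sub>M std_gaussian n) (\<lambda>p. H (\<lambda>i. a * fst p i + b * snd p i))"
    and "(\<integral>p. H (\<lambda>i. a * fst p i + b * snd p i) \<partial>(std_gaussian n \<Otimes>\<^sub>M std_gaussian n)) = (\<integral>z. H z \<partial>std_gaussian n)"
    and "(\<integral>x. (\<integral>y. H (\<lambda>i. a * x i + b * y i) \<partial>std_gaussian n) \<partial>std_gaussian n) = (\<integral>z. H z \<partial>std_gaussian n)"
proof -
  let ?P = "std_gaussian n \<Otimes>\<^sub>M std_gaussian n"
  let ?T = "\<lambda>p. \<lambda>i\<in>{..<n}. a * fst p i + b * snd p i"
  have T: "?T \<in> measurable ?P (std_gaussian n)"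
    unfolding measurable_cong_sets[OF refl sets_std_gaussian]
    by (intro measurable_restrict) measurable
  have d: "distr ?P (std_gaussian n) ?T = std_gaussian n"
    using std_gaussian_convolution[OF ab, of n] by (simp add: case_prod_beta')
  have m: "H \<in> borel_measurable (std_gaussian n)" using int by simp
  show 1: "integrable ?P (\<lambda>p. H (\<lambda>i. a * fst p i + b * snd p i))"
    using integrable_distr_eq[OF T m] int by (simp add: d H)
  show 2: "(\<integral>p. H (\<lambda>i. a * fst p i + b * snd p i) \<partial>?P) = (\<integral>z. H z \<partial>std_gaussian n)"
    using integral_distr[OF T m] by (simp add: d H)
  show "(\<integral>x. (\<integral>y. H (\<lambda>i. a * x i + b * y i) \<partial>std_gaussian n) \<partial>std_gaussian n) = (\<integral>z. H z \<partial>std_gaussian n)"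
    using std_gaussian_pair.integral_fst'[OF 1] 2 by simp
qed

definition smooth :: "nat \<Rightarrow> real \<Rightarrow> ((nat \<Rightarrow> real) \<Rightarrow> real) \<Rightarrow> (nat \<Rightarrow> real) \<Rightarrow> real" where
  "smooth n r g w = (\<integral>y. g (\<lambda>j. w j + r * y j) \<partial>std_gaussian n)"

text \<open>Gaussian integration by parts: this is \<open>r\<close> times the \<open>i\<close>-th partial derivative of
  \<open>smooth n r g\<close>, in a form that makes sense for nonsmooth \<open>g\<close>.\<close>

definition smooth_grad :: "nat \<Rightarrow> real \<Rightarrow> ((nat \<Rightarrow> real) \<Rightarrow> real) \<Rightarrow> nat \<Rightarrow> (nat \<Rightarrow> real) \<Rightarrow> real" where
  "smooth_grad n r g i w = (\<integral>y. g (\<lambda>j. w j + r * y j) * y i \<partial>std_gaussian n)"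

context
  fixes n :: nat and g :: "(nat \<Rightarrow> real) \<Rightarrow> real" and r :: real
  assumes g: "lipschitz_fun n 1 g" "convex_fun g" and r: "r \<ge> 0"
begin

lemma lipschitz_shifted: "lipschitz_fun n r (\<lambda>y. g (\<lambda>j. w j + r * y j))"
  using lipschitz_fun_affine[OF g(1) r] by simp

lemmas integrable_shifted = integrable_lipschitz_fun[OF lipschitz_shifted r]

lemma lipschitz_smooth: "lipschitz_fun n 1 (smooth n r g)"
  unfolding lipschitz_fun_def
proof (intro allI)
  fix w w'
  have "\<bar>smooth n r g w - smooth n r g w'\<bar>
      = \<bar>\<integral>y. g (\<lambda>j. w j + r * y j) - g (\<lambda>j. w' j + r * y j) \<partial>std_gaussian n\<bar>"
    unfolding smooth_def using integrable_shifted(1) by simp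
  also have "\<dots> \<le> (\<integral>y. \<bar>g (\<lambda>j. w j + r * y j) - g (\<lambda>j. w' j + r * y j)\<bar> \<partial>std_gaussian n)"
    by (rule integral_abs_bound)
  also have "\<dots> \<le> (\<integral>y. L2_set (\<lambda>i. w i - w' i) {..<n} \<partial>std_gaussian n)"
  proof (rule integral_mono)
    show "integrable (std_gaussian n) (\<lambda>y. \<bar>g (\<lambda>j. w j + r * y j) - g (\<lambda>j. w' j + r * y j)\<bar>)"
      by (intro integrable_abs Bochner_Integration.integrable_diff integrable_shifted(1))
    show "\<bar>g (\<lambda>j. w j + r * y j) - g (\<lambda>j. w' j + r * y j)\<bar> \<le> L2_set (\<lambda>i. w i - w' i) {..<n}" for y
      using lipschitz_funD[OF g(1), of "\<lambda>j. w j + r * y j" "\<lambda>j. w' j + r * y j"] by simp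
  qed simp
  finally show "\<bar>smooth n r g w - smooth n r g w'\<bar> \<le> 1 * L2_set (\<lambda>i. w i - w' i) {..<n}"
    using std_gaussian.prob_space[of n] by simp
qed

text \<open>The constant 1 comes from E |y i| \<le> 1. This is the second-order control of the
  smoothed function, which \<open>g\<close> itself does not provide.\<close>

lemma lipschitz_smooth_grad:
  assumes i: "i < n"
  shows "lipschitz_fun n 1 (smooth_grad n r g i)"
  unfolding lipschitz_fun_def
proof (intro allI)
  fix w w'
  let ?d = "L2_set (\<lambda>i. w i - w' i) {..<n}"
  have "\<bar>smooth_grad n r g i w - smooth_grad n r g i w'\<bar>
      = \<bar>\<integral>y. g (\<lambda>j. w j + r * y j) * y i - g (\<lambda>j. w' j + r * y j) * y i \<partial>std_gaussian n\<bar>"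
    unfolding smooth_grad_def using integrable_shifted(3) by simp
  also have "\<dots> \<le> (\<integral>y. \<bar>g (\<lambda>j. w j + r * y j) * y i - g (\<lambda>j. w' j + r * y j) * y i\<bar> \<partial>std_gaussian n)"
    by (rule integral_abs_bound)
  also have "\<dots> \<le> (\<integral>y. ?d * \<bar>y i\<bar> \<partial>std_gaussian n)"
  proof (rule integral_mono)
    show "integrable (std_gaussian n) (\<lambda>y. \<bar>g (\<lambda>j. w j + r * y j) * y i - g (\<lambda>j. w' j + r * y j) * y i\<bar>)"
      by (intro integrable_abs Bochner_Integration.integrable_diff integrable_shifted(3))
    show "integrable (std_gaussian n) (\<lambda>y. ?d * \<bar>y i\<bar>)"
      using std_gaussian_first_abs_moment[OF i] by simp
    fix y :: "nat \<Rightarrow> real"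
    have "\<bar>g (\<lambda>j. w j + r * y j) - g (\<lambda>j. w' j + r * y j)\<bar> * \<bar>y i\<bar> \<le> ?d * \<bar>y i\<bar>"
      using lipschitz_funD[OF g(1), of "\<lambda>j. w j + r * y j" "\<lambda>j. w' j + r * y j"]
      by (intro mult_right_mono) auto
    then show "\<bar>g (\<lambda>j. w j + r * y j) * y i - g (\<lambda>j. w' j + r * y j) * y i\<bar> \<le> ?d * \<bar>y i\<bar>"
      by (simp add: abs_mult flip: left_diff_distrib)
  qed
  also have "\<dots> = ?d * (\<integral>y. \<bar>y i\<bar> \<partial>std_gaussian n)" by simp
  also have "\<dots> \<le> ?d * 1"
    using std_gaussian_first_abs_moment[OF i] by (intro mult_left_mono) auto
  finally show "\<bar>smooth_grad n r g i w - smooth_grad n r g i w'\<bar> \<le> 1 * ?d" by simp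
qed

text \<open>Translating \<open>y\<close> by \<open>h\<close> in g(w + r y) moves \<open>w\<close> by
  r h, so this is \<open>std_gaussian_subgradient\<close> for the rescaled function; the factor
  \<open>r\<close> inside \<open>smooth_grad\<close> matches the step r h.\<close>

lemma smooth_subgradient:
  "(\<Sum>i<n. h i * smooth_grad n r g i w) \<le> smooth n r g (\<lambda>j. w j + r * h j) - smooth n r g w"
proof -
  have "(\<lambda>j. w j + r * (y j + h j)) = (\<lambda>j. (w j + r * h j) + r * y j)" for y
    by (auto simp: algebra_simps)
  with std_gaussian_subgradient[OF lipschitz_shifted r convex_fun_affine[OF g(2)], of h w]
  show ?thesis by (simp add: smooth_def smooth_grad_def)
qed

text \<open>Test the subgradient inequality in the direction b itself: |b|^2 \<le> F(w + r b) - F(w)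
  \<le> r |b|, where F is the smoothed function.\<close>

lemma smooth_grad_norm_le: "L2_set (\<lambda>i. smooth_grad n r g i w) {..<n} \<le> r"
proof -
  let ?b = "\<lambda>i. smooth_grad n r g i w"
  let ?s = "L2_set ?b {..<n}"
  have "?s * ?s = (\<Sum>i<n. ?b i * ?b i)"
    by (simp add: L2_set_def sum_nonneg power2_eq_square flip: real_sqrt_mult)
  also have "\<dots> \<le> smooth n r g (\<lambda>j. w j + r * ?b j) - smooth n r g w"
    by (rule smooth_subgradient)
  also have "\<dots> \<le> L2_set (\<lambda>j. r * ?b j) {..<n}"
    using lipschitz_funD[OF lipschitz_smooth, of "\<lambda>j. w j + r * ?b j" w] by simp
  also have "\<dots> = r * ?s" using r by (simp add: L2_set_right_distrib)
  finally have "?s * ?s \<le> r * ?s" .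
  moreover have "?s \<ge> 0" by simp
  ultimately show ?thesis using r by (cases "?s = 0") auto
qed

lemma smooth_grad_le:
  assumes "i < n"
  shows "\<bar>smooth_grad n r g i w\<bar> \<le> r"
proof -
  have "\<bar>smooth_grad n r g i w\<bar> \<le> L2_set (\<lambda>i. \<bar>smooth_grad n r g i w\<bar>) {..<n}"
    using assms by (intro member_le_L2_set) auto
  also have "\<dots> = L2_set (\<lambda>i. smooth_grad n r g i w) {..<n}" by (simp add: L2_set_def)
  finally show ?thesis using smooth_grad_norm_le[of w] by linarith
qed

text \<open>The noise has the same size \<open>r\<close> as the smoothing, so
  \<open>smooth_grad\<close> is the gradient in \<open>y\<close> without further factors. The
  increment along a coordinate lies between the subgradient inequalities at its two end points,
  which differ by the Lipschitz bound on the gradient; this is the quadratic remainder.\<close>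

lemma smooth_poincare:
  "(\<integral>y. (smooth n r g (\<lambda>j. w j + r * y j))\<^sup>2 \<partial>std_gaussian n)
    \<le> (\<integral>y. smooth n r g (\<lambda>j. w j + r * y j) \<partial>std_gaussian n)\<^sup>2
      + (\<Sum>i<n. \<integral>y. (smooth_grad n r g i (\<lambda>j. w j + r * y j))\<^sup>2 \<partial>std_gaussian n)"
proof (rule std_gaussian_poincare)
  let ?F = "\<lambda>y. smooth n r g (\<lambda>j. w j + r * y j)"
  let ?b = "\<lambda>i y. smooth_grad n r g i (\<lambda>j. w j + r * y j)"
  have F: "lipschitz_fun n r ?F"
    using lipschitz_fun_affine[OF lipschitz_smooth r] by simp
  show "?F \<in> borel_measurable (std_gaussian n)"
    by (rule measurable_lipschitz_fun_std_gaussian[OF F])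
  show "?b i \<in> borel_measurable (std_gaussian n)" if "i < n" for i
    by (rule measurable_lipschitz_fun_std_gaussian[OF lipschitz_fun_affine[OF lipschitz_smooth_grad[OF that] r]])
  show "\<bar>?F x\<bar> \<le> (\<bar>?F (\<lambda>_. 0)\<bar> + r) * exp (\<Sum>i<n. \<bar>x i\<bar>)" for x
    by (rule lipschitz_fun_growth[OF F r])
  show "\<bar>?b i x\<bar> \<le> r" if "i < n" for i x
    by (rule smooth_grad_le[OF that])
  show "\<bar>?F (x(i := t)) - ?F x - ?b i x * (t - x i)\<bar> \<le> r * (t - x i)\<^sup>2" if i: "i < n" for x i t
  proof -
    have sum: "(\<Sum>k<n. (if k = i then c else 0) * d k) = c * d i" for c :: real and d
    proof -
      have "(\<Sum>k<n. (if k = i then c else 0) * d k) = (\<Sum>k<n. if k = i then c * d k else 0)"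
        by (intro sum.cong) auto
      then show ?thesis using i by simp
    qed
    have "(t - x i) * ?b i x \<le> smooth n r g (\<lambda>j. w j + r * x j + r * (if j = i then t - x i else 0)) - ?F x"
      using smooth_subgradient[of "\<lambda>k. if k = i then t - x i else 0" "\<lambda>j. w j + r * x j"] unfolding sum .
    moreover have "(\<lambda>j. w j + r * x j + r * (if j = i then t - x i else 0)) = (\<lambda>j. w j + r * (x(i := t)) j)"
      by (auto simp: algebra_simps)
    ultimately have lower: "(t - x i) * ?b i x \<le> ?F (x(i := t)) - ?F x" by simp
    have "(x i - t) * ?b i (x(i := t))
        \<le> smooth n r g (\<lambda>j. w j + r * (x(i := t)) j + r * (if j = i then x i - t else 0)) - ?F (x(i := t))"
      using smooth_subgradient[of "\<lambda>k. if k = i then x i - t else 0" "\<lambda>j. w j + r * (x(i := t)) j"] unfolding sum .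
    moreover have "(\<lambda>j. w j + r * (x(i := t)) j + r * (if j = i then x i - t else 0)) = (\<lambda>j. w j + r * x j)"
      by (auto simp: algebra_simps)
    ultimately have upper: "?F (x(i := t)) - ?F x \<le> (t - x i) * ?b i (x(i := t))"
      by (simp add: algebra_simps)
    have "L2_set (\<lambda>k. (x(i := t)) k - x k) {..<n} = \<bar>t - x i\<bar>"
    proof -
      have "(\<Sum>k<n. ((x(i := t)) k - x k)\<^sup>2) = (\<Sum>k<n. if k = i then (t - x i)\<^sup>2 else 0)"
        by (intro sum.cong) auto
      then show ?thesis using i by (simp add: L2_set_def)
    qed
    then have "\<bar>?b i (x(i := t)) - ?b i x\<bar> \<le> r * \<bar>t - x i\<bar>"
      using lipschitz_funD[OF lipschitz_fun_affine[OF lipschitz_smooth_grad[OF i] r, of w], of "x(i := t)" x] by simp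
    then have "\<bar>t - x i\<bar> * \<bar>?b i (x(i := t)) - ?b i x\<bar> \<le> \<bar>t - x i\<bar> * (r * \<bar>t - x i\<bar>)"
      by (rule mult_left_mono) simp
    also have "\<dots> = r * (t - x i)\<^sup>2" by (simp add: power2_eq_square)
    finally have "(t - x i) * ?b i (x(i := t)) - (t - x i) * ?b i x \<le> r * (t - x i)\<^sup>2"
      unfolding right_diff_distrib[symmetric] abs_mult[symmetric] by linarith
    with lower upper show ?thesis by (simp add: mult.commute)
  qed
qed

end

section \<open>Variance across scales\<close>

text \<open>Two independent noises of size \<open>r\<close> add up to one of size sqrt 2 r.\<close>

lemma smooth_semigroup:
  assumes g: "lipschitz_fun n 1 g" and r: "r \<ge> 0"
  shows "(\<integral>y. smooth n r g (\<lambda>j. w j + r * y j) \<partial>std_gaussian n) = smooth n (sqrt 2 * r) g w"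
proof -
  have sq: "sqrt 2 * r \<ge> 0" using r by simp
  note lip = lipschitz_fun_affine[OF g sq, of w]
  have c: "1 / sqrt 2 * (sqrt 2 * r) = r" by simp
  have "smooth n (sqrt 2 * r) g w = (\<integral>x. (\<integral>y. g (\<lambda>j. w j + sqrt 2 * r * (1 / sqrt 2 * x j + 1 / sqrt 2 * y j))
      \<partial>std_gaussian n) \<partial>std_gaussian n)"
    unfolding smooth_def
    using integrable_lipschitz_fun(1)[OF lip] sq lipschitz_fun_restrict[OF lip]
    by (intro std_gaussian_convolution_integral(3)[symmetric]) (auto simp: power_divide)
  also have "\<dots> = (\<integral>x. (\<integral>y. g (\<lambda>j. w j + r * x j + r * y j) \<partial>std_gaussian n) \<partial>std_gaussian n)"
  proof -
    have "w j + sqrt 2 * r * (1 / sqrt 2 * x + 1 / sqrt 2 * y) = w j + r * x + r * y" for j x y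
      by (simp add: distrib_left)
    then show ?thesis by (simp only:)
  qed
  finally show ?thesis by (simp add: smooth_def)
qed

lemma scaled_convolution_integral:
  assumes h: "lipschitz_fun n L h" "L \<ge> 0" and ab: "a \<ge> 0" "r \<ge> 0"
  shows "integrable (std_gaussian n \<Otimes>\<^sub>M std_gaussian n) (\<lambda>p. (h (\<lambda>j. a * fst p j + r * snd p j))\<^sup>2)"
    and "(\<integral>x. (\<integral>y. (h (\<lambda>j. a * x j + r * y j))\<^sup>2 \<partial>std_gaussian n) \<partial>std_gaussian n)
      = (\<integral>z. (h (\<lambda>j. sqrt (a\<^sup>2 + r\<^sup>2) * z j))\<^sup>2 \<partial>std_gaussian n)"
proof -
  define p where "p = sqrt (a\<^sup>2 + r\<^sup>2)"
  \<comment> \<open>If \<open>p = 0\<close>, then \<open>a\<close> and \<open>r\<close> both vanish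
    and any unit vector would do; (1, 0) is taken.\<close>
  define c s where "c = (if p = 0 then 1 else a / p)" and "s = (if p = 0 then 0 else r / p)"
  have p2: "p\<^sup>2 = a\<^sup>2 + r\<^sup>2" by (simp add: p_def)
  have p: "p \<ge> 0" by (simp add: p_def)
  have a: "a = p * c" and rr: "r = p * s"
    using p2 by (auto simp: c_def s_def sum_power2_eq_zero_iff)
  have cs: "c\<^sup>2 + s\<^sup>2 = 1" "c \<ge> 0" "s \<ge> 0"
    using ab p p2 by (auto simp: c_def s_def power_divide simp flip: add_divide_distrib)
  have lip: "lipschitz_fun n (L * p) (\<lambda>z. h (\<lambda>j. 0 + p * z j))"
    by (rule lipschitz_fun_affine[OF h(1) p])
  have int: "integrable (std_gaussian n) (\<lambda>z. (h (\<lambda>j. p * z j))\<^sup>2)"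
    using integrable_lipschitz_fun(2)[OF lip] h(2) p by simp
  have res: "(h (\<lambda>j. p * restrict x {..<n} j))\<^sup>2 = (h (\<lambda>j. p * x j))\<^sup>2" for x
    using lipschitz_fun_restrict[OF lip, of x] by simp
  have eq: "(\<lambda>j. a * x j + r * y j) = (\<lambda>j. p * (c * x j + s * y j))" for x y :: "nat \<Rightarrow> real"
    by (simp add: a rr algebra_simps)
  show "integrable (std_gaussian n \<Otimes>\<^sub>M std_gaussian n) (\<lambda>p. (h (\<lambda>j. a * fst p j + r * snd p j))\<^sup>2)"
    using std_gaussian_convolution_integral(1)[OF cs int res] by (simp only: eq)
  show "(\<integral>x. (\<integral>y. (h (\<lambda>j. a * x j + r * y j))\<^sup>2 \<partial>std_gaussian n) \<partial>std_gaussian n)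
      = (\<integral>z. (h (\<lambda>j. sqrt (a\<^sup>2 + r\<^sup>2) * z j))\<^sup>2 \<partial>std_gaussian n)"
    using std_gaussian_convolution_integral(3)[OF cs int res] by (simp only: eq p_def)
qed

text \<open>Second moment of E[g(p X + r Y) | X] with p^2 + r^2 = 1. It interpolates between E g^2
  at r = 0 and (E g)^2 at r = 1.\<close>

definition smooth_energy :: "nat \<Rightarrow> real \<Rightarrow> ((nat \<Rightarrow> real) \<Rightarrow> real) \<Rightarrow> real" where
  "smooth_energy n r g = (\<integral>x. (smooth n r g (\<lambda>j. sqrt (1 - r\<^sup>2) * x j))\<^sup>2 \<partial>std_gaussian n)"

definition grad_energy :: "nat \<Rightarrow> real \<Rightarrow> ((nat \<Rightarrow> real) \<Rightarrow> real) \<Rightarrow> real" where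
  "grad_energy n r g =
    (\<integral>x. (\<Sum>i<n. (smooth_grad n r g i (\<lambda>j. sqrt (1 - r\<^sup>2) * x j))\<^sup>2) \<partial>std_gaussian n)"

text \<open>Replace p X by a X + r Y with a^2 = 1 - 2 r^2 and apply the Poincare inequality in
  \<open>Y\<close> for fixed \<open>X\<close>. By the semigroup property the conditional mean is the
  smoothing at scale sqrt 2 r, and \<open>a\<close> is the factor belonging to that scale; in the
  gradient term a X + r Y recombines to p X.\<close>

lemma smooth_energy_step:
  assumes g: "lipschitz_fun n 1 g" "convex_fun g" and r: "r \<ge> 0" "2 * r\<^sup>2 \<le> 1"
  shows "smooth_energy n r g \<le> smooth_energy n (sqrt 2 * r) g + grad_energy n r g"
proof -
  let ?G = "std_gaussian n"
  let ?p = "sqrt (1 - r\<^sup>2)" and ?a = "sqrt (1 - 2 * r\<^sup>2)"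
  have a: "?a \<ge> 0" using r by simp
  have p: "sqrt (?a\<^sup>2 + r\<^sup>2) = ?p" using r by simp
  have q: "sqrt (1 - (sqrt 2 * r)\<^sup>2) = ?a" by (simp add: power_mult_distrib)
  have sq: "sqrt 2 * r \<ge> 0" using r by simp
  note lipF = lipschitz_smooth[OF g r(1)] and lipb = lipschitz_smooth_grad[OF g r(1)]
  let ?F = "\<lambda>x y. smooth n r g (\<lambda>j. ?a * x j + r * y j)"
  let ?b = "\<lambda>i x y. smooth_grad n r g i (\<lambda>j. ?a * x j + r * y j)"
  have iF: "integrable ?G (\<lambda>x. \<integral>y. (?F x y)\<^sup>2 \<partial>?G)"
    using std_gaussian_pair.integrable_fst'[OF scaled_convolution_integral(1)[OF lipF _ a r(1)]] by simp
  have ib: "integrable ?G (\<lambda>x. \<integral>y. (?b i x y)\<^sup>2 \<partial>?G)" if "i < n" for i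
    using std_gaussian_pair.integrable_fst'[OF scaled_convolution_integral(1)[OF lipb[OF that] _ a r(1)]] by simp
  have lipS: "lipschitz_fun n (1 * ?a) (\<lambda>x. smooth n (sqrt 2 * r) g (\<lambda>j. 0 + ?a * x j))"
    by (rule lipschitz_fun_affine[OF lipschitz_smooth[OF g sq] a])
  have iS: "integrable ?G (\<lambda>x. (smooth n (sqrt 2 * r) g (\<lambda>j. ?a * x j))\<^sup>2)"
    using integrable_lipschitz_fun(2)[OF lipS] a by simp
  have ip: "integrable ?G (\<lambda>x. (smooth_grad n r g i (\<lambda>j. ?p * x j))\<^sup>2)" if "i < n" for i
  proof -
    have "0 \<le> ?p" using r by simp
    from lipschitz_fun_affine[OF lipb[OF that] this, of "\<lambda>_. 0"]
    show ?thesis using integrable_lipschitz_fun(2) \<open>0 \<le> ?p\<close> by fastforce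
  qed
  have "smooth_energy n r g = (\<integral>x. (\<integral>y. (?F x y)\<^sup>2 \<partial>?G) \<partial>?G)"
    unfolding smooth_energy_def using scaled_convolution_integral(2)[OF lipF _ a r(1)] p by simp
  also have "\<dots> \<le> (\<integral>x. (smooth n (sqrt 2 * r) g (\<lambda>j. ?a * x j))\<^sup>2 + (\<Sum>i<n. \<integral>y. (?b i x y)\<^sup>2 \<partial>?G) \<partial>?G)"
  proof (rule integral_mono)
    show "integrable ?G (\<lambda>x. (smooth n (sqrt 2 * r) g (\<lambda>j. ?a * x j))\<^sup>2 + (\<Sum>i<n. \<integral>y. (?b i x y)\<^sup>2 \<partial>?G))"
      by (intro Bochner_Integration.integrable_add iS Bochner_Integration.integrable_sum ib) simp
    show "(\<integral>y. (?F x y)\<^sup>2 \<partial>?G) \<le> (smooth n (sqrt 2 * r) g (\<lambda>j. ?a * x j))\<^sup>2 + (\<Sum>i<n. \<integral>y. (?b i x y)\<^sup>2 \<partial>?G)" for x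
      using smooth_poincare[OF g r(1), of "\<lambda>j. ?a * x j"]
      unfolding smooth_semigroup[OF g(1) r(1), of "\<lambda>j. ?a * x j"] .
  qed (rule iF)
  also have "\<dots> = smooth_energy n (sqrt 2 * r) g + (\<Sum>i<n. \<integral>x. (\<integral>y. (?b i x y)\<^sup>2 \<partial>?G) \<partial>?G)"
    unfolding smooth_energy_def q
    by (subst Bochner_Integration.integral_add[OF iS]; (subst Bochner_Integration.integral_sum)?)
       (auto intro!: Bochner_Integration.integrable_sum ib)
  also have "(\<Sum>i<n. \<integral>x. (\<integral>y. (?b i x y)\<^sup>2 \<partial>?G) \<partial>?G) = (\<Sum>i<n. \<integral>x. (smooth_grad n r g i (\<lambda>j. ?p * x j))\<^sup>2 \<partial>?G)"
    using scaled_convolution_integral(2)[OF lipb _ a r(1)] p by (intro sum.cong) auto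
  also have "\<dots> = grad_energy n r g"
    unfolding grad_energy_def using ip by (subst Bochner_Integration.integral_sum) auto
  finally show ?thesis .
qed

text \<open>For fixed \<open>x\<close> the variance in \<open>y\<close> is at most the second moment
  about g(p x), which the Lipschitz bound controls by r^2 E |y|^2 = r^2 n. The dimension does no
  harm because r tends to 0 with n fixed.\<close>

lemma smooth_energy_remainder:
  assumes g: "lipschitz_fun n 1 g" "convex_fun g" and r: "0 \<le> r" "r \<le> 1"
  shows "(\<integral>x. (g x)\<^sup>2 \<partial>std_gaussian n) \<le> smooth_energy n r g + r\<^sup>2 * real n"
proof -
  let ?G = "std_gaussian n"
  let ?p = "sqrt (1 - r\<^sup>2)"
  have r2: "r\<^sup>2 \<le> 1" using r by (simp add: power_le_one)
  have p: "?p \<ge> 0" using r2 by simp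
  have one: "sqrt (?p\<^sup>2 + r\<^sup>2) = 1" using r2 by simp
  let ?g = "\<lambda>x y. g (\<lambda>j. ?p * x j + r * y j)"
  have ig: "integrable ?G (\<lambda>x. \<integral>y. (?g x y)\<^sup>2 \<partial>?G)"
    using std_gaussian_pair.integrable_fst'[OF scaled_convolution_integral(1)[OF g(1) _ p r(1)]] by simp
  have iS: "integrable ?G (\<lambda>x. (smooth n r g (\<lambda>j. ?p * x j))\<^sup>2)"
    using integrable_lipschitz_fun(2)[OF lipschitz_fun_affine[OF lipschitz_smooth[OF g r(1)] p, of "\<lambda>_. 0"]] p by simp
  have var: "(\<integral>y. (?g x y)\<^sup>2 \<partial>?G) \<le> (smooth n r g (\<lambda>j. ?p * x j))\<^sup>2 + r\<^sup>2 * real n" for x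
  proof -
    let ?c = "g (\<lambda>j. ?p * x j)" and ?m = "smooth n r g (\<lambda>j. ?p * x j)"
    note i = integrable_shifted[OF g r(1), of "\<lambda>j. ?p * x j"]
    have m: "?m = (\<integral>y. ?g x y \<partial>?G)" by (simp add: smooth_def)
    have sq: "(?g x y - ?c)\<^sup>2 = (?g x y)\<^sup>2 - 2 * ?c * ?g x y + ?c\<^sup>2" for y
      by (simp add: power2_diff)
    have "(\<integral>y. (?g x y - ?c)\<^sup>2 \<partial>?G) = (\<integral>y. (?g x y)\<^sup>2 \<partial>?G) - 2 * ?c * ?m + ?c\<^sup>2"
      unfolding sq m using i(1,2) std_gaussian.prob_space[of n] by simp
    moreover have "(\<integral>y. (?g x y - ?c)\<^sup>2 \<partial>?G) \<le> (\<integral>y. r\<^sup>2 * (\<Sum>i<n. (y i)\<^sup>2) \<partial>?G)"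
    proof (rule integral_mono)
      show "integrable ?G (\<lambda>y. (?g x y - ?c)\<^sup>2)"
        unfolding sq using i(1,2) by simp
      show "integrable ?G (\<lambda>y. r\<^sup>2 * (\<Sum>i<n. (y i)\<^sup>2))"
        using std_gaussian_second_moment by auto
      fix y :: "nat \<Rightarrow> real"
      have "\<bar>?g x y - ?c\<bar> \<le> r * L2_set y {..<n}"
        using lipschitz_funD[OF lipschitz_shifted[OF g r(1)], of "\<lambda>j. ?p * x j" y "\<lambda>_. 0"] by simp
      from power_mono[OF this, of 2]
      show "(?g x y - ?c)\<^sup>2 \<le> r\<^sup>2 * (\<Sum>i<n. (y i)\<^sup>2)"
        by (simp add: power_mult_distrib L2_set_def sum_nonneg)
    qed
    moreover have "(\<integral>y. r\<^sup>2 * (\<Sum>i<n. (y i)\<^sup>2) \<partial>?G) = r\<^sup>2 * real n"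
      using std_gaussian_second_moment by simp
    moreover have "2 * ?c * ?m \<le> ?c\<^sup>2 + ?m\<^sup>2" by (rule sum_squares_bound[of ?c ?m])
    ultimately show ?thesis by linarith
  qed
  have "(\<integral>x. (g x)\<^sup>2 \<partial>?G) = (\<integral>x. (\<integral>y. (?g x y)\<^sup>2 \<partial>?G) \<partial>?G)"
    using scaled_convolution_integral(2)[OF g(1) _ p r(1)] one by simp
  also have "\<dots> \<le> (\<integral>x. (smooth n r g (\<lambda>j. ?p * x j))\<^sup>2 + r\<^sup>2 * real n \<partial>?G)"
    using ig iS var by (intro integral_mono) auto
  also have "\<dots> = smooth_energy n r g + r\<^sup>2 * real n"
    unfolding smooth_energy_def using iS std_gaussian.prob_space[of n] by simp
  finally show ?thesis .
qed

text \<open>Telescoping \<open>smooth_energy_step\<close> over \<open>r = 2\<^bsup>-j/2\<^esup>\<close> writes the variance as a sum of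
  gradient energies; since the scales themselves are summable, one scale has gradient energy
  of order \<open>\<alpha>\<^sup>2 r\<close>.\<close>

lemma exists_scale:
  assumes g: "lipschitz_fun n 1 g" "convex_fun g" and \<alpha>: "\<alpha> > 0"
    and var: "(\<integral>x. (g x)\<^sup>2 \<partial>std_gaussian n) - (\<integral>x. g x \<partial>std_gaussian n)\<^sup>2 \<ge> \<alpha>\<^sup>2"
  shows "\<exists>r. 0 < r \<and> r \<le> 1 \<and> \<alpha>\<^sup>2 / 4 * r \<le> grad_energy n r g"
proof (rule ccontr)
  assume no: "\<not> ?thesis"
  define \<rho> where "\<rho> j = (1 / sqrt 2) ^ j" for j :: nat
  have \<rho>0: "\<rho> j > 0" for j by (simp add: \<rho>_def)
  have \<rho>_Suc: "sqrt 2 * \<rho> (Suc j) = \<rho> j" for j by (simp add: \<rho>_def)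
  have sq: "(\<rho> j)\<^sup>2 = (1 / 2) ^ j" for j
    unfolding \<rho>_def power_mult[symmetric] mult.commute[of j 2] unfolding power_mult by (simp add: power_divide)
  \<comment> \<open>A rational ratio for the geometric series, small enough for the sum below to
    stay under \<alpha>^2.\<close>
  have s2: "1 / sqrt 2 \<le> (3 / 4 :: real)"
  proof -
    have "(4 / 3)\<^sup>2 \<le> (2 :: real)" by (simp add: power2_eq_square)
    then have "4 / 3 \<le> sqrt 2" by (rule real_le_rsqrt)
    then show ?thesis by (simp add: field_simps)
  qed
  have \<rho>1: "\<rho> j \<le> 1" for j using s2 by (simp add: \<rho>_def power_le_one)
  have \<rho>_le: "\<rho> j \<le> (3 / 4) ^ j" for j
    unfolding \<rho>_def using s2 by (intro power_mono) auto
  have small: "grad_energy n (\<rho> j) g \<le> \<alpha>\<^sup>2 / 4 * (3 / 4) ^ j" for j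
  proof -
    have "grad_energy n (\<rho> j) g \<le> \<alpha>\<^sup>2 / 4 * \<rho> j"
      using no \<rho>0[of j] \<rho>1[of j] by (meson not_le less_imp_le)
    also have "\<dots> \<le> \<alpha>\<^sup>2 / 4 * (3 / 4) ^ j" using \<rho>_le[of j] by (intro mult_left_mono) auto
    finally show ?thesis .
  qed
  have step: "smooth_energy n (\<rho> (Suc j)) g \<le> smooth_energy n (\<rho> j) g + \<alpha>\<^sup>2 / 4 * (3 / 4) ^ Suc j" for j
  proof -
    have "2 * (\<rho> (Suc j))\<^sup>2 \<le> 1" unfolding sq by (simp add: power_le_one)
    from smooth_energy_step[OF g less_imp_le[OF \<rho>0] this] small[of "Suc j"]
    show ?thesis unfolding \<rho>_Suc by linarith
  qed
  \<comment> \<open>At scale 1 the factor sqrt (1 - r^2) is 0, so no dependence on \<open>x\<close>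
    remains.\<close>
  have zero: "smooth_energy n (\<rho> 0) g = (\<integral>x. g x \<partial>std_gaussian n)\<^sup>2"
    using std_gaussian.prob_space[of n] by (simp add: smooth_energy_def smooth_def \<rho>_def)
  \<comment> \<open>The terms \<alpha>^2 / 4 times (3/4)^j with j \<ge> 1 sum to 3/4 \<alpha>^2. The
    missing \<alpha>^2 / 4 would have to come from the remainder 2^(-j) n, which is impossible for
    large j.\<close>
  have tele: "smooth_energy n (\<rho> j) g \<le> (\<integral>x. g x \<partial>std_gaussian n)\<^sup>2 + \<alpha>\<^sup>2 * (3 / 4) * (1 - (3 / 4) ^ j)" for j
  proof (induction j)
    case (Suc j)
    have "\<alpha>\<^sup>2 * (3 / 4) * (1 - q) + \<alpha>\<^sup>2 / 4 * (3 / 4 * q) = \<alpha>\<^sup>2 * (3 / 4) * (1 - 3 / 4 * q)" for q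
      by (simp add: field_simps)
    from this[of "(3 / 4) ^ j"] Suc step[of j] show ?case unfolding power_Suc by linarith
  qed (simp add: zero)
  have bound: "\<alpha>\<^sup>2 / 4 \<le> (1 / 2) ^ j * real n" for j
  proof -
    have "\<alpha>\<^sup>2 * (3 / 4) * (1 - (3 / 4) ^ j) \<le> \<alpha>\<^sup>2 * (3 / 4) * 1"
      by (intro mult_left_mono) auto
    then show ?thesis
      using smooth_energy_remainder[OF g less_imp_le[OF \<rho>0] \<rho>1, of j] tele[of j] var
      unfolding sq by simp
  qed
  have "(\<lambda>j. (1 / 2 :: real) ^ j * real n) \<longlonglongrightarrow> 0 * real n"
    by (intro tendsto_mult_right LIMSEQ_realpow_zero) auto
  then have "\<alpha>\<^sup>2 / 4 \<le> 0 * real n"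
    by (rule LIMSEQ_le_const) (use bound in auto)
  with \<alpha> show False by simp
qed

section \<open>Deviation from an arbitrary level\<close>

text \<open>Cauchy-Schwarz for the shift density and \<open>H\<close>, in the form of the
  arithmetic-geometric mean inequality with a free weight \<open>l\<close>. The bound is linear in
  the integral of \<open>H\<close>, so it can later be integrated over a shift that depends on
  another variable.\<close>

lemma std_gaussian_shift_le:
  fixes H :: "(nat \<Rightarrow> real) \<Rightarrow> real" and l :: real
  assumes [measurable]: "H \<in> borel_measurable (std_gaussian n)"
    and res: "\<And>x. H (restrict x {..<n}) = H x" and H: "\<And>x. 0 \<le> H x" "\<And>x. H x \<le> 1" and l: "l > 0"
  shows "(\<integral>y. H (\<lambda>i. y i + h i) \<partial>std_gaussian n)
    \<le> (l * (\<integral>y. H y \<partial>std_gaussian n) + exp (\<Sum>i<n. (h i)\<^sup>2) / l) / 2"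
proof -
  let ?G = "std_gaussian n"
  define \<rho> where "\<rho> k y = exp (\<Sum>i<n. k i * y i - (k i)\<^sup>2 / 2)" for k y :: "nat \<Rightarrow> real"
  have \<rho>1: "(\<integral>y. \<rho> k y \<partial>?G) = 1" for k
    using std_gaussian_shift_integral[of "\<lambda>_. 1" n k] std_gaussian.prob_space[of n] by (simp add: \<rho>_def)
  \<comment> \<open>A non-integrable function has Bochner integral 0, so the value 1 proves
    integrability.\<close>
  then have i\<rho>: "integrable ?G (\<rho> k)" for k
    using not_integrable_integral_eq[of ?G "\<rho> k"] by fastforce
  \<comment> \<open>The squared density is exp(|h|^2) times the density of the shift by 2 h; hence
    its integral is exp(|h|^2).\<close>
  have sq: "(\<rho> h y)\<^sup>2 = exp (\<Sum>i<n. (h i)\<^sup>2) * \<rho> (\<lambda>i. 2 * h i) y" for y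
  proof -
    have "2 * (\<Sum>i<n. h i * y i - (h i)\<^sup>2 / 2) = (\<Sum>i<n. (h i)\<^sup>2) + (\<Sum>i<n. 2 * h i * y i - (2 * h i)\<^sup>2 / 2)"
      unfolding sum_distrib_left sum.distrib[symmetric] by (intro sum.cong) (auto simp: power_mult_distrib)
    then show ?thesis unfolding \<rho>_def by (simp add: exp_add flip: exp_double)
  qed
  have iH: "integrable ?G H"
    using H by (intro std_gaussian.integrable_const_bound[where B = 1]) auto
  have pt: "\<rho> h y * H y \<le> (l * H y + (\<rho> h y)\<^sup>2 / l) / 2" for y
  proof -
    have "0 \<le> (l * H y - \<rho> h y)\<^sup>2 / l" using l by simp
    also have "\<dots> = l * (H y * H y) - 2 * (\<rho> h y * H y) + (\<rho> h y)\<^sup>2 / l"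
      using l by (simp add: power2_diff power2_eq_square field_simps)
    also have "\<dots> \<le> l * (H y * 1) - 2 * (\<rho> h y * H y) + (\<rho> h y)\<^sup>2 / l"
      using mult_left_mono[OF mult_left_mono[OF H(2) H(1), of y y], of l] l by simp
    finally show ?thesis by simp
  qed
  have i2: "integrable ?G (\<lambda>y. (l * H y + (\<rho> h y)\<^sup>2 / l) / 2)"
    unfolding sq using iH i\<rho> by simp
  have [measurable]: "\<rho> h \<in> borel_measurable ?G" using i\<rho> by simp
  have "(\<integral>y. H (\<lambda>i. y i + h i) \<partial>?G) = (\<integral>y. \<rho> h y * H y \<partial>?G)"
    unfolding \<rho>_def by (rule std_gaussian_shift_integral[OF assms(1) res])
  also have "\<dots> \<le> (\<integral>y. (l * H y + (\<rho> h y)\<^sup>2 / l) / 2 \<partial>?G)"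
  proof (rule integral_mono[OF _ i2 pt])
    show "integrable ?G (\<lambda>y. \<rho> h y * H y)"
    proof (rule Bochner_Integration.integrable_bound[OF i\<rho>[of h]])
      show "AE y in ?G. norm (\<rho> h y * H y) \<le> norm (\<rho> h y)"
        using H by (auto simp: abs_mult intro!: AE_I2 mult_left_le)
    qed measurable
  qed
  also have "\<dots> = (l * (\<integral>y. H y \<partial>?G) + exp (\<Sum>i<n. (h i)\<^sup>2) / l) / 2"
    unfolding sq using iH i\<rho> \<rho>1 by simp
  finally show ?thesis .
qed

lemma lipschitz_convex_deviation:
  fixes m t \<alpha> :: real
  assumes g: "lipschitz_fun n 1 g" "convex_fun g" and \<alpha>: "0 < \<alpha>" "\<alpha> \<le> 1" and t: "t > 0"
    and var: "(\<integral>x. (g x)\<^sup>2 \<partial>std_gaussian n) - (\<integral>x. g x \<partial>std_gaussian n)\<^sup>2 \<ge> \<alpha>\<^sup>2"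
  shows "\<alpha> ^ 4 / 80 * exp (- (256 / \<alpha> ^ 4) * t\<^sup>2)
    \<le> measure (std_gaussian n) {z \<in> space (std_gaussian n). \<bar>g z - m\<bar> \<ge> t}"
proof -
  let ?G = "std_gaussian n" and ?P = "std_gaussian n \<Otimes>\<^sub>M std_gaussian n"
  obtain r where r: "0 < r" "r \<le> 1" and energy: "\<alpha>\<^sup>2 / 4 * r \<le> grad_energy n r g"
    using exists_scale[OF g \<alpha>(1) var] by blast
  define p where "p = sqrt (1 - r\<^sup>2)"
  have p: "p\<^sup>2 + r\<^sup>2 = 1" "p \<ge> 0"
    using r by (simp_all add: p_def power_le_one)
  \<comment> \<open>Makes 2 t half of the mean gain \<kappa> \<alpha>^2 / 4; the other half bounds
    from below the probability of gaining at least 2 t.\<close>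
  define \<kappa> where "\<kappa> = 16 * t / \<alpha>\<^sup>2"
  have \<kappa>: "\<kappa> > 0" using t \<alpha> by (simp add: \<kappa>_def)
  have \<kappa>t: "2 * t = \<kappa> * \<alpha>\<^sup>2 / 8" using \<alpha> by (simp add: \<kappa>_def)
  define b where "b i x = smooth_grad n r g i (\<lambda>j. p * x j)" for i x
  define h where "h x i = \<kappa> / r * b i x" for x i
  \<comment> \<open>\<open>g1\<close> is the value before the shift and has the law of
    \<open>g\<close>; \<open>g2\<close> is the value after it. The vector \<open>h x\<close> depends
    on \<open>x\<close> alone.\<close>
  define g1 where "g1 x y = g (\<lambda>j. p * x j + r * y j)" for x y
  define g2 where "g2 x y = g1 x (\<lambda>j. y j + h x j)" for x y
  note r0 = less_imp_le[OF r(1)]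
  have lip1: "lipschitz_fun n r (g1 x)" for x
    unfolding g1_def[abs_def] by (rule lipschitz_shifted[OF g r0])
  have lipb: "lipschitz_fun n p (b i)" if "i < n" for i
    unfolding b_def[abs_def]
    using lipschitz_fun_affine[OF lipschitz_smooth_grad[OF g r0 that] p(2), of "\<lambda>_. 0"] by simp
  have h_norm: "L2_set (h x) {..<n} \<le> \<kappa>" for x
  proof -
    have "L2_set (h x) {..<n} = \<kappa> / r * L2_set (\<lambda>i. b i x) {..<n}"
      unfolding h_def using \<kappa> r by (subst L2_set_right_distrib) auto
    also have "\<dots> \<le> \<kappa> / r * r"
      unfolding b_def using \<kappa> r by (intro mult_left_mono smooth_grad_norm_le[OF g r0]) auto
    finally show ?thesis using r by simp
  qed
  have h_sq: "(\<Sum>i<n. (h x i)\<^sup>2) \<le> \<kappa>\<^sup>2" for x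
    using power_mono[OF h_norm[of x], of 2] by (simp add: L2_set_def sum_nonneg)
  have D_abs: "\<bar>g2 x y - g1 x y\<bar> \<le> \<kappa>" for x y
  proof -
    have "\<bar>g2 x y - g1 x y\<bar> \<le> r * L2_set (h x) {..<n}"
      unfolding g2_def using lipschitz_funD[OF lip1, of x "\<lambda>j. y j + h x j" y] by simp
    also have "\<dots> \<le> 1 * \<kappa>" using r h_norm[of x] \<kappa> by (intro mult_mono) auto
    finally show ?thesis by simp
  qed
  have m1[measurable]: "(\<lambda>q. g1 (fst q) (snd q)) \<in> borel_measurable ?P"
    unfolding g1_def by (rule measurable_lipschitz_fun[OF g(1)]) measurable
  have mb[measurable]: "(\<lambda>q. b i (fst q)) \<in> borel_measurable ?P" if "i < n" for i
    by (rule measurable_lipschitz_fun[OF lipb[OF that]]) measurable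
  have m2[measurable]: "(\<lambda>q. g2 (fst q) (snd q)) \<in> borel_measurable ?P"
    unfolding g2_def g1_def h_def
    by (rule measurable_lipschitz_fun[OF g(1)])
       (intro borel_measurable_add borel_measurable_times borel_measurable_const mb measurable_std_gaussian_pair_component; assumption)
  let ?D = "\<lambda>q. g2 (fst q) (snd q) - g1 (fst q) (snd q)"
  let ?U = "\<lambda>q. indicator {2 * t..} (?D q) :: real"
  let ?V = "\<lambda>q. indicator {..m - t} (g1 (fst q) (snd q)) :: real"
  let ?W = "\<lambda>q. indicator {m + t..} (g2 (fst q) (snd q)) :: real"
  have iD: "integrable ?P ?D"
    using D_abs by (intro std_gaussian_pair.integrable_const_bound[where B = \<kappa>]) auto
  have iU: "integrable ?P ?U" by (intro std_gaussian_pair.integrable_const_bound[where B = 1]) auto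
  have iV: "integrable ?P ?V" by (intro std_gaussian_pair.integrable_const_bound[where B = 1]) auto
  have iW: "integrable ?P ?W" by (intro std_gaussian_pair.integrable_const_bound[where B = 1]) auto
  define Pr where "Pr = measure ?G {z \<in> space ?G. \<bar>g z - m\<bar> \<ge> t}"
  have [measurable]: "g \<in> borel_measurable ?G"
    by (rule measurable_lipschitz_fun_std_gaussian[OF g(1)])
  have Pr_ge: "(\<integral>z. indicator S (g z) \<partial>?G) \<le> Pr"
    if S: "S \<in> sets borel" "\<And>s. s \<in> S \<Longrightarrow> \<bar>s - m\<bar> \<ge> t" for S :: "real set"
  proof -
    have "(\<integral>z. indicator S (g z) \<partial>?G) = (\<integral>z. indicator {z \<in> space ?G. g z \<in> S} z \<partial>?G :: real)"
      by (intro Bochner_Integration.integral_cong) (auto simp: indicator_def)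
    also have "\<dots> = measure ?G {z \<in> space ?G. g z \<in> S}"
      using S(1) by simp
    also have "\<dots> \<le> Pr"
      unfolding Pr_def using S by (intro std_gaussian.finite_measure_mono) auto
    finally show ?thesis .
  qed
  have conv: "(\<integral>q. indicator S (g1 (fst q) (snd q)) \<partial>?P) = (\<integral>z. indicator S (g z) \<partial>?G :: real)"
    if [measurable]: "S \<in> sets borel" for S
    unfolding g1_def
  proof (rule std_gaussian_convolution_integral(2)[OF p(1,2) r0])
    show "integrable ?G (\<lambda>z. indicator S (g z) :: real)"
      by (intro std_gaussian.integrable_const_bound[where B = 1]) auto
  qed (simp add: lipschitz_fun_restrict[OF g(1)])
  have "\<kappa> * \<alpha>\<^sup>2 / 4 \<le> \<kappa> / r * grad_energy n r g"
    using mult_left_mono[OF energy, of "\<kappa> / r"] \<kappa> r by simp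
  also have "\<dots> \<le> (\<integral>x. (\<integral>y. g2 x y - g1 x y \<partial>?G) \<partial>?G)"
  proof -
    have lb: "\<kappa> / r * (\<Sum>i<n. (b i x)\<^sup>2) \<le> (\<integral>y. g2 x y - g1 x y \<partial>?G)" for x
    proof -
      have 2: "g2 x y = g (\<lambda>j. (p * x j + r * h x j) + r * y j)" for y
        unfolding g2_def g1_def by (rule arg_cong[of _ _ g]) (simp add: algebra_simps)
      have "\<kappa> / r * (\<Sum>i<n. (b i x)\<^sup>2) = (\<Sum>i<n. h x i * smooth_grad n r g i (\<lambda>j. p * x j))"
        by (simp add: h_def b_def sum_distrib_left power2_eq_square mult.assoc)
      also have "\<dots> \<le> smooth n r g (\<lambda>j. p * x j + r * h x j) - smooth n r g (\<lambda>j. p * x j)"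
        by (rule smooth_subgradient[OF g r0])
      also have "\<dots> = (\<integral>y. g2 x y - g1 x y \<partial>?G)"
        unfolding smooth_def 2 g1_def using integrable_shifted(1)[OF g r0] by simp
      finally show ?thesis .
    qed
    have ib: "integrable ?G (\<lambda>x. (b i x)\<^sup>2)" if "i < n" for i
      using integrable_lipschitz_fun(2)[OF lipb[OF that] p(2)] .
    have "\<kappa> / r * grad_energy n r g = (\<integral>x. \<kappa> / r * (\<Sum>i<n. (b i x)\<^sup>2) \<partial>?G)"
      unfolding grad_energy_def b_def p_def by (rule integral_mult_right_zero[symmetric])
    also have "\<dots> \<le> (\<integral>x. (\<integral>y. g2 x y - g1 x y \<partial>?G) \<partial>?G)"
      using lb std_gaussian_pair.integrable_fst'[OF iD]
      by (intro integral_mono integrable_mult_right Bochner_Integration.integrable_sum ib) auto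
    finally show ?thesis .
  qed
  also have "\<dots> = (\<integral>q. ?D q \<partial>?P)"
    using std_gaussian_pair.integral_fst'[OF iD] by simp
  \<comment> \<open>Reverse Markov inequality: the gain never exceeds \<kappa>, so a large mean
    forces a large probability of reaching 2 t.\<close>
  also have "\<dots> \<le> (\<integral>q. \<kappa> * ?U q + 2 * t \<partial>?P)"
  proof (rule integral_mono[OF iD])
    show "integrable ?P (\<lambda>q. \<kappa> * ?U q + 2 * t)" using iU by simp
    fix q
    show "?D q \<le> \<kappa> * ?U q + 2 * t"
      using D_abs[of "fst q" "snd q"] t by (auto simp: indicator_def)
  qed
  also have "\<dots> = \<kappa> * (\<integral>q. ?U q \<partial>?P) + 2 * t"
    using iU std_gaussian_pair.prob_space[of n n] by simp
  finally have "\<kappa> * (\<alpha>\<^sup>2 / 8) \<le> \<kappa> * (\<integral>q. ?U q \<partial>?P)"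
    using \<kappa>t by linarith
  then have "\<alpha>\<^sup>2 / 8 \<le> (\<integral>q. ?U q \<partial>?P)" using \<kappa> by simp
  \<comment> \<open>If g1 > m - t and g2 < m + t, then the gain is below 2 t.\<close>
  also have "\<dots> \<le> (\<integral>q. ?V q + ?W q \<partial>?P)"
  proof (rule integral_mono[OF iU])
    show "integrable ?P (\<lambda>q. ?V q + ?W q)" using iV iW by simp
  qed (auto simp: indicator_def)
  also have "\<dots> = (\<integral>q. ?V q \<partial>?P) + (\<integral>q. ?W q \<partial>?P)"
    using iV iW by simp
  finally have UVW: "\<alpha>\<^sup>2 / 8 \<le> (\<integral>q. ?V q \<partial>?P) + (\<integral>q. ?W q \<partial>?P)" .
  have V: "(\<integral>q. ?V q \<partial>?P) \<le> Pr"
    unfolding conv[of "{..m - t}", simplified] by (rule Pr_ge) auto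
  \<comment> \<open>For fixed \<open>x\<close> the shift is constant. The bound of
    \<open>std_gaussian_shift_le\<close> is linear in the unshifted probability, so integrating over
    \<open>x\<close> leads back to the law of \<open>g\<close> and to \<open>Pr\<close>.\<close>
  have W: "(\<integral>q. ?W q \<partial>?P) \<le> (l * Pr + exp (\<kappa>\<^sup>2) / l) / 2" if l: "l > 0" for l
  proof -
    let ?H = "\<lambda>x y. indicator {m + t..} (g1 x y) :: real"
    have iH: "integrable ?P (\<lambda>q. ?H (fst q) (snd q))"
      by (intro std_gaussian_pair.integrable_const_bound[where B = 1]) auto
    have "(\<integral>q. ?W q \<partial>?P) = (\<integral>x. (\<integral>y. ?H x (\<lambda>j. y j + h x j) \<partial>?G) \<partial>?G)"
      using std_gaussian_pair.integral_fst'[OF iW] by (simp add: g2_def)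
    also have "\<dots> \<le> (\<integral>x. (l * (\<integral>y. ?H x y \<partial>?G) + exp (\<kappa>\<^sup>2) / l) / 2 \<partial>?G)"
    proof (rule integral_mono)
      show "integrable ?G (\<lambda>x. \<integral>y. ?H x (\<lambda>j. y j + h x j) \<partial>?G)"
        using std_gaussian_pair.integrable_fst'[OF iW] by (simp add: g2_def)
      show "integrable ?G (\<lambda>x. (l * (\<integral>y. ?H x y \<partial>?G) + exp (\<kappa>\<^sup>2) / l) / 2)"
        using std_gaussian_pair.integrable_fst'[OF iH] by simp
      fix x
      have [measurable]: "g1 x \<in> borel_measurable ?G"
        by (rule measurable_lipschitz_fun_std_gaussian[OF lip1])
      have "(\<integral>y. ?H x (\<lambda>j. y j + h x j) \<partial>?G)
          \<le> (l * (\<integral>y. ?H x y \<partial>?G) + exp (\<Sum>i<n. (h x i)\<^sup>2) / l) / 2"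
        by (rule std_gaussian_shift_le) (auto simp: l lipschitz_fun_restrict[OF lip1])
      also have "\<dots> \<le> (l * (\<integral>y. ?H x y \<partial>?G) + exp (\<kappa>\<^sup>2) / l) / 2"
        using h_sq[of x] l by (intro divide_right_mono add_left_mono) auto
      finally show "(\<integral>y. ?H x (\<lambda>j. y j + h x j) \<partial>?G) \<le> (l * (\<integral>y. ?H x y \<partial>?G) + exp (\<kappa>\<^sup>2) / l) / 2" .
    qed
    also have "\<dots> = (l * (\<integral>q. ?H (fst q) (snd q) \<partial>?P) + exp (\<kappa>\<^sup>2) / l) / 2"
      using std_gaussian_pair.integrable_fst'[OF iH] std_gaussian_pair.integral_fst'[OF iH]
        std_gaussian.prob_space[of n] by simp
    also have "\<dots> \<le> (l * Pr + exp (\<kappa>\<^sup>2) / l) / 2"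
    proof -
      have "(\<integral>q. ?H (fst q) (snd q) \<partial>?P) \<le> Pr"
        unfolding conv[of "{m + t..}", simplified] by (rule Pr_ge) auto
      then show ?thesis using l by (intro divide_right_mono add_right_mono mult_left_mono) auto
    qed
    finally show ?thesis .
  qed
  \<comment> \<open>This weight \<open>l\<close> turns exp(\<kappa>^2) / (2 l) into \<alpha>^2 / 16,
    half of the \<alpha>^2 / 8 available.\<close>
  have "0 < 8 * (exp (\<kappa>\<^sup>2) / \<alpha>\<^sup>2)" using \<alpha> by simp
  from W[OF this] have "(\<integral>q. ?W q \<partial>?P) \<le> 4 * (exp (\<kappa>\<^sup>2) / \<alpha>\<^sup>2 * Pr) + \<alpha>\<^sup>2 / 16"
    by simp
  with UVW V have 1: "\<alpha>\<^sup>2 / 16 \<le> Pr + 4 * (exp (\<kappa>\<^sup>2) / \<alpha>\<^sup>2 * Pr)" by linarith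
  \<comment> \<open>Since exp(\<kappa>^2) / \<alpha>^2 \<ge> 1, the two terms with \<open>Pr\<close>
    merge into 5 times the larger one, and 80 = 16 * 5.\<close>
  have "1 * \<alpha>\<^sup>2 \<le> exp (\<kappa>\<^sup>2) * 1" using \<alpha> by (intro mult_mono) (auto simp: power_le_one)
  then have 2: "1 * Pr \<le> exp (\<kappa>\<^sup>2) / \<alpha>\<^sup>2 * Pr"
    using \<alpha> by (intro mult_right_mono) (auto simp: Pr_def)
  have "a / 80 \<le> c" if "a / 16 \<le> d + 4 * c" "1 * d \<le> c" for a c d :: real
    using that by linarith
  from this[OF 1 2] have "\<alpha>\<^sup>2 / 80 \<le> exp (\<kappa>\<^sup>2) / \<alpha>\<^sup>2 * Pr" .
  then have "\<alpha>\<^sup>2 / 80 * \<alpha>\<^sup>2 \<le> exp (\<kappa>\<^sup>2) * Pr" using \<alpha> by (simp add: pos_le_divide_eq)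
  then have "\<alpha>\<^sup>2 / 80 * \<alpha>\<^sup>2 * exp (- \<kappa>\<^sup>2) \<le> exp (\<kappa>\<^sup>2) * Pr * exp (- \<kappa>\<^sup>2)"
    by (rule mult_right_mono) simp
  also have "\<dots> = Pr" by (simp add: exp_minus)
  finally show ?thesis
    by (simp add: Pr_def \<kappa>_def power_divide power_mult_distrib flip: power_mult power_add)
qed

text \<open>The bound for 1-Lipschitz functions is applied to f / L at the level m / L. Its
  constants \<open>\<alpha> ^ 4 / 80\<close> and \<open>256 / \<alpha> ^ 4\<close> meet the required
  ones because \<alpha>^8 \<le> \<alpha>^4 and ln (e / \<alpha>) \<ge> 1 on (0, 1].\<close>

theorem theorem1p1:
  shows "\<exists>c\<^sub>\<alpha> C\<^sub>\<alpha> :: real \<Rightarrow> real.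
    (\<forall>\<alpha>::real. 0 < \<alpha> \<and> \<alpha> \<le> 1 \<longrightarrow>
       c\<^sub>\<alpha> \<alpha> > 0 \<and> C\<^sub>\<alpha> \<alpha> > 0 \<and>
       (\<forall>(n::nat) (L::real) (f :: (nat \<Rightarrow> real) \<Rightarrow> real) (m::real).
          n \<ge> 1 \<longrightarrow> convex_Rn n f \<longrightarrow> lipschitz_Rn n L f \<longrightarrow>
          is_median (std_gaussian n) f m \<longrightarrow>
          prob_space.variance (std_gaussian n) f \<ge> \<alpha>\<^sup>2 * L\<^sup>2 \<longrightarrow>
          (\<forall>t>0. measure (std_gaussian n) {z \<in> space (std_gaussian n). \<bar>f z - m\<bar> \<ge> t * L}
                   \<ge> c\<^sub>\<alpha> \<alpha> * exp (- C\<^sub>\<alpha> \<alpha> * t\<^sup>2)))) \<and>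
    (\<exists>c C :: real. c > 0 \<and> C > 0 \<and>
       (\<forall>\<alpha>::real. 0 < \<alpha> \<and> \<alpha> \<le> 1 \<longrightarrow>
          c\<^sub>\<alpha> \<alpha> \<ge> c * \<alpha> ^ 8 \<and> C\<^sub>\<alpha> \<alpha> \<le> C * (1 / \<alpha> ^ 4) * ln (exp 1 / \<alpha>)))"
proof (rule exI[of _ "\<lambda>\<alpha>. \<alpha> ^ 4 / 80"], rule exI[of _ "\<lambda>\<alpha>. 256 / \<alpha> ^ 4"], intro conjI allI impI)
  fix \<alpha> L m t :: real and n :: nat and f :: "(nat \<Rightarrow> real) \<Rightarrow> real"
  assume \<alpha>: "0 < \<alpha> \<and> \<alpha> \<le> 1" and conv: "convex_Rn n f" and lip: "lipschitz_Rn n L f"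
    and var: "prob_space.variance (std_gaussian n) f \<ge> \<alpha>\<^sup>2 * L\<^sup>2" and t: "t > 0"
  have "L \<ge> 0" using lip by (simp add: lipschitz_Rn_def)
  then consider "L = 0" | "L > 0" by linarith
  then show "\<alpha> ^ 4 / 80 * exp (- (256 / \<alpha> ^ 4) * t\<^sup>2)
      \<le> measure (std_gaussian n) {z \<in> space (std_gaussian n). \<bar>f z - m\<bar> \<ge> t * L}"
  proof cases
    case 1
    \<comment> \<open>For L = 0 the event is the whole space.\<close>
    have "\<alpha> ^ 4 \<le> 1" using \<alpha> by (simp add: power_le_one)
    then have "\<alpha> ^ 4 / 80 * exp (- (256 / \<alpha> ^ 4) * t\<^sup>2) \<le> 1 * 1"
      using \<alpha> by (intro mult_mono) auto
    then show ?thesis using 1 std_gaussian.prob_space[of n] by simp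
  next
    case 2
    \<comment> \<open>Restricting the argument extends \<open>f\<close> from \<open>Rn n\<close> to
      all sequences, the domain of \<open>lipschitz_fun\<close> and
      \<open>convex_fun\<close>.\<close>
    define g where "g x = f (restrict x {..<n}) / L" for x
    have Rn: "restrict x {..<n} \<in> Rn n" for x :: "nat \<Rightarrow> real"
      by (auto simp: Rn_def)
    have fg: "f x = L * g x" if "x \<in> space (std_gaussian n)" for x
      using that 2 by (simp add: g_def space_std_gaussian Rn_def PiE_restrict)
    have g: "lipschitz_fun n 1 g"
      unfolding lipschitz_fun_def
    proof (intro allI)
      fix x y :: "nat \<Rightarrow> real"
      have "\<bar>f (restrict x {..<n}) - f (restrict y {..<n})\<bar>
          \<le> L * L2_set (\<lambda>i. restrict x {..<n} i - restrict y {..<n} i) {..<n}"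
        using lip Rn unfolding lipschitz_Rn_def by blast
      also have "L2_set (\<lambda>i. restrict x {..<n} i - restrict y {..<n} i) {..<n} = L2_set (\<lambda>i. x i - y i) {..<n}"
        by (rule L2_set_cong) auto
      finally show "\<bar>g x - g y\<bar> \<le> 1 * L2_set (\<lambda>i. x i - y i) {..<n}"
        using 2 by (simp add: g_def abs_divide pos_divide_le_eq mult.commute del: restrict_apply flip: diff_divide_distrib)
    qed
    have g': "convex_fun g"
      unfolding convex_fun_def
    proof (intro allI impI)
      fix x y :: "nat \<Rightarrow> real" and u v :: real assume uv: "u \<ge> 0" "v \<ge> 0" "u + v = 1"
      have "f (\<lambda>i\<in>{..<n}. u * restrict x {..<n} i + v * restrict y {..<n} i)
          \<le> u * f (restrict x {..<n}) + v * f (restrict y {..<n})"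
        using conv Rn uv unfolding convex_Rn_def by blast
      also have "(\<lambda>i\<in>{..<n}. u * restrict x {..<n} i + v * restrict y {..<n} i) = (\<lambda>i\<in>{..<n}. u * x i + v * y i)"
        by auto
      finally have "f (\<lambda>i\<in>{..<n}. u * x i + v * y i) / L
          \<le> (u * f (restrict x {..<n}) + v * f (restrict y {..<n})) / L"
        by (rule divide_right_mono) (use 2 in simp)
      then show "g (\<lambda>i. u * x i + v * y i) \<le> u * g x + v * g y"
        by (simp add: g_def add_divide_distrib)
    qed
    note int = integrable_lipschitz_fun(1,2)[OF g zero_le_one]
    have exp: "(\<integral>x. f x \<partial>std_gaussian n) = L * (\<integral>x. g x \<partial>std_gaussian n)"
      unfolding integral_mult_right_zero[symmetric]
      by (rule Bochner_Integration.integral_cong) (auto simp: fg)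
    have "std_gaussian.variance n f = L\<^sup>2 * std_gaussian.variance n g"
      unfolding exp integral_mult_right_zero[symmetric]
      by (rule Bochner_Integration.integral_cong)
         (auto simp: fg power_mult_distrib[symmetric] right_diff_distrib)
    also have "std_gaussian.variance n g = (\<integral>x. (g x)\<^sup>2 \<partial>std_gaussian n) - (\<integral>x. g x \<partial>std_gaussian n)\<^sup>2"
      by (rule std_gaussian.variance_eq[OF int])
    finally have "\<alpha>\<^sup>2 \<le> (\<integral>x. (g x)\<^sup>2 \<partial>std_gaussian n) - (\<integral>x. g x \<partial>std_gaussian n)\<^sup>2"
      using var 2 by (simp add: mult.commute)
    from lipschitz_convex_deviation[OF g g' _ _ t this, of "m / L"] \<alpha>
    have "\<alpha> ^ 4 / 80 * exp (- (256 / \<alpha> ^ 4) * t\<^sup>2)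
        \<le> measure (std_gaussian n) {z \<in> space (std_gaussian n). \<bar>g z - m / L\<bar> \<ge> t}" by simp
    also have "{z \<in> space (std_gaussian n). \<bar>g z - m / L\<bar> \<ge> t} = {z \<in> space (std_gaussian n). \<bar>f z - m\<bar> \<ge> t * L}"
    proof (rule Collect_cong, rule conj_cong[OF refl])
      fix z assume z: "z \<in> space (std_gaussian n)"
      have "f z - m = L * (g z - m / L)" using 2 by (simp add: fg[OF z] right_diff_distrib)
      then have "\<bar>f z - m\<bar> = \<bar>g z - m / L\<bar> * L" using 2 by (simp add: abs_mult)
      then show "t \<le> \<bar>g z - m / L\<bar> \<longleftrightarrow> t * L \<le> \<bar>f z - m\<bar>" using 2 by simp
    qed
    finally show ?thesis .
  qed
next
  show "\<exists>c C :: real. c > 0 \<and> C > 0 \<and>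
       (\<forall>\<alpha>::real. 0 < \<alpha> \<and> \<alpha> \<le> 1 \<longrightarrow>
          \<alpha> ^ 4 / 80 \<ge> c * \<alpha> ^ 8 \<and> 256 / \<alpha> ^ 4 \<le> C * (1 / \<alpha> ^ 4) * ln (exp 1 / \<alpha>))"
  proof (rule exI[of _ "1 / 80"], rule exI[of _ 256], intro conjI allI impI)
    fix \<alpha> :: real assume \<alpha>: "0 < \<alpha> \<and> \<alpha> \<le> 1"
    show "1 / 80 * \<alpha> ^ 8 \<le> \<alpha> ^ 4 / 80"
      using \<alpha> power_decreasing[of 4 8 \<alpha>] by simp
    have "ln (exp 1 / \<alpha>) = 1 - ln \<alpha>" using \<alpha> by (simp add: ln_div)
    moreover have "ln \<alpha> \<le> 0" using \<alpha> by simp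
    ultimately have "256 * (1 / \<alpha> ^ 4) * 1 \<le> 256 * (1 / \<alpha> ^ 4) * ln (exp 1 / \<alpha>)"
      using \<alpha> by (intro mult_left_mono) auto
    then show "256 / \<alpha> ^ 4 \<le> 256 * (1 / \<alpha> ^ 4) * ln (exp 1 / \<alpha>)" by simp
  qed simp_all
qed simp_all

end
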